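(* Let $\Omega\subset\mathbb{R}^N$ be a bounded open set with a Lipschitz continuous boundary. Let $0<t<s<1$, $2<\frac Ns<p\le\infty$, $1\le p'=\frac{p}{p-1}<2$ and $\frac1{p'}<t<1$. Then for every $z\in\widetilde W^{-t,p}(\Omega)$ there is a unique solution $u\in\widetilde W_0^{s,2}(\Omega)$ of the Dirichlet problem $$(-\Delta)^su=z\ \text{ in }\Omega,\qquad u=0\ \text{ in }\mathbb{R}^N\setminus\Omega .$$ In addition, $u\in L^\infty(\Omega)$ and there is a constant $C>0$, independent of $z$, such that $$\|u\|_{L^\infty(\Omega)}\le C\|z\|_{\widetilde W^{-t,p}(\Omega)} .$$
   Context: All functions are real valued. For $0<\sigma<1$ and $1\le q<\infty$, $W^{\sigma,q}(\mathbb{R}^N)$ is the space of $u\in L^q(\mathbb{R}^N)$ with $\int_{\mathbb{R}^N}\int_{\mathbb{R}^N}\frac{|u(x)-u(y)|^q}{|x-y|^{N+\sigma q}}\,dx\,dy<\infty$, and $\widetilde W_0^{\sigma,q}(\Omega):=\{u\in W^{\sigma,q}(\mathbb{R}^N):u=0\text{ on }\mathbb{R}^N\setminus\Omega\}$, normed by $\|u\|_{\widetilde W_0^{\sigma,q}(\Omega)}=\big(\int_{\mathbb{R}^N}\int_{\mathbb{R}^N}\frac{|u(x)-u(y)|^q}{|x-y|^{N+\sigma q}}\,dx\,dy\big)^{1/q}$ (equivalent to the full $W^{\sigma,q}(\mathbb{R}^N)$ norm on this space). $\widetilde W^{-\sigma,q'}(\Omega)$ denotes the dual of $\widetilde W_0^{\sigma,q}(\Omega)$,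 $\frac1q+\frac1{q'}=1$; thus $\widetilde W^{-t,p}(\Omega)=(\widetilde W_0^{t,p'}(\Omega))^\star$. Under the stated hypotheses $\widetilde W_0^{s,2}(\Omega)\hookrightarrow\widetilde W_0^{t,p'}(\Omega)$ continuously. With $C_{N,s}:=\frac{s2^{2s}\Gamma(\frac{2s+N}{2})}{\pi^{N/2}\Gamma(1-s)}$, a solution of the Dirichlet problem with $z\in\widetilde W^{-t,p}(\Omega)$ is a function $u\in\widetilde W_0^{s,2}(\Omega)$ such that $$\frac{C_{N,s}}{2}\int_{\mathbb{R}^N}\int_{\mathbb{R}^N}\frac{(u(x)-u(y))(v(x)-v(y))}{|x-y|^{N+2s}}\,dx\,dy=\langle z,v\rangle_{\widetilde W^{-t,p}(\Omega),\widetilde W_0^{t,p'}(\Omega)}\quad\text{for all }v\in\widetilde W_0^{s,2}(\Omega).$$ *)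

theory Defs
  imports "HOL-Analysis.Analysis" "HOL-Probability.Essential_Supremum"
begin

text \<open>
  Elements of the function spaces below are everywhere-defined, Lebesgue measurable
  representatives; equality in these spaces means equality almost everywhere.
\<close>

text \<open>Near each boundary point the set is, in rotated coordinates with vertical direction
  \<open>e\<close>, the strict epigraph of a Lipschitz function of the horizontal variable.\<close>

definition lipschitz_boundary :: "'a::euclidean_space set \<Rightarrow> bool" where
  "lipschitz_boundary \<Omega> \<longleftrightarrow>
     (\<forall>x\<in>frontier \<Omega>. \<exists>r>0. \<exists>e L. \<exists>\<phi> :: 'a \<Rightarrow> real.
        norm e = 1 \<and> lipschitz_on L {y. y \<bullet> e = 0} \<phi> \<and>
        \<Omega> \<inter> ball x r = {y \<in> ball x r. \<phi> (y - (y \<bullet> e) *\<^sub>R e) < y \<bullet> e})"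

definition gagliardo_energy :: "real \<Rightarrow> real \<Rightarrow> ('a::euclidean_space \<Rightarrow> real) \<Rightarrow> ennreal" where
  "gagliardo_energy \<sigma> q u =
     (\<integral>\<^sup>+ (x, y). ennreal (\<bar>u x - u y\<bar> powr q / dist x y powr (real DIM('a) + \<sigma> * q))
        \<partial>(lebesgue \<Otimes>\<^sub>M lebesgue))"

definition frac_sobolev :: "real \<Rightarrow> real \<Rightarrow> ('a::euclidean_space \<Rightarrow> real) set" where
  "frac_sobolev \<sigma> q =
     {u \<in> borel_measurable lebesgue.
        integrable lebesgue (\<lambda>x. \<bar>u x\<bar> powr q) \<and> gagliardo_energy \<sigma> q u < \<infinity>}"

definition frac_sobolev0 :: "'a::euclidean_space set \<Rightarrow> real \<Rightarrow> real \<Rightarrow> ('a \<Rightarrow> real) set" where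
  "frac_sobolev0 \<Omega> \<sigma> q = {u \<in> frac_sobolev \<sigma> q. AE x in lebesgue. x \<notin> \<Omega> \<longrightarrow> u x = 0}"

definition frac_sobolev0_norm :: "real \<Rightarrow> real \<Rightarrow> ('a::euclidean_space \<Rightarrow> real) \<Rightarrow> real" where
  "frac_sobolev0_norm \<sigma> q u = enn2real (gagliardo_energy \<sigma> q u) powr (1 / q)"

text \<open>Bounded linear functionals on \<open>frac_sobolev0\<close>. Only the values on that space matter.
  Boundedness and linearity force a functional to agree on functions that are equal almost
  everywhere.\<close>

definition frac_sobolev0_dual ::
    "'a::euclidean_space set \<Rightarrow> real \<Rightarrow> real \<Rightarrow> (('a \<Rightarrow> real) \<Rightarrow> real) set" where
  "frac_sobolev0_dual \<Omega> \<sigma> q =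
     {z. (\<forall>u\<in>frac_sobolev0 \<Omega> \<sigma> q. \<forall>v\<in>frac_sobolev0 \<Omega> \<sigma> q. z (\<lambda>x. u x + v x) = z u + z v) \<and>
         (\<forall>c. \<forall>u\<in>frac_sobolev0 \<Omega> \<sigma> q. z (\<lambda>x. c * u x) = c * z u) \<and>
         (\<exists>B. \<forall>u\<in>frac_sobolev0 \<Omega> \<sigma> q. \<bar>z u\<bar> \<le> B * frac_sobolev0_norm \<sigma> q u)}"

definition frac_sobolev0_dual_norm ::
    "'a::euclidean_space set \<Rightarrow> real \<Rightarrow> real \<Rightarrow> (('a \<Rightarrow> real) \<Rightarrow> real) \<Rightarrow> real" where
  "frac_sobolev0_dual_norm \<Omega> \<sigma> q z =
     (SUP u\<in>{u \<in> frac_sobolev0 \<Omega> \<sigma> q. frac_sobolev0_norm \<sigma> q u \<le> 1}. \<bar>z u\<bar>)"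

definition conj_exponent :: "ereal \<Rightarrow> real" where
  "conj_exponent p = (if p = \<infinity> then 1 else real_of_ereal p / (real_of_ereal p - 1))"

definition neg_sobolev ::
    "'a::euclidean_space set \<Rightarrow> real \<Rightarrow> ereal \<Rightarrow> (('a \<Rightarrow> real) \<Rightarrow> real) set" where
  "neg_sobolev \<Omega> t p = frac_sobolev0_dual \<Omega> t (conj_exponent p)"

definition neg_sobolev_norm ::
    "'a::euclidean_space set \<Rightarrow> real \<Rightarrow> ereal \<Rightarrow> (('a \<Rightarrow> real) \<Rightarrow> real) \<Rightarrow> real" where
  "neg_sobolev_norm \<Omega> t p z = frac_sobolev0_dual_norm \<Omega> t (conj_exponent p) z"

definition frac_laplacian_const :: "nat \<Rightarrow> real \<Rightarrow> real" where
  "frac_laplacian_const N s =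
     s * 2 powr (2 * s) * Gamma ((2 * s + real N) / 2) / (pi powr (real N / 2) * Gamma (1 - s))"

definition frac_laplacian_form ::
    "real \<Rightarrow> ('a::euclidean_space \<Rightarrow> real) \<Rightarrow> ('a \<Rightarrow> real) \<Rightarrow> real" where
  "frac_laplacian_form s u v =
     frac_laplacian_const DIM('a) s / 2 *
     (\<integral>(x, y). (u x - u y) * (v x - v y) / dist x y powr (real DIM('a) + 2 * s)
        \<partial>(lebesgue \<Otimes>\<^sub>M lebesgue))"

text \<open>Solutions of the Dirichlet problem for the fractional Laplacian with right-hand side \<open>z\<close>.
  The duality pairing of \<open>z\<close> with \<open>v\<close> is application.\<close>

definition dirichlet_solution ::
    "'a::euclidean_space set \<Rightarrow> real \<Rightarrow> (('a \<Rightarrow> real) \<Rightarrow> real) \<Rightarrow> ('a \<Rightarrow> real) \<Rightarrow> bool" where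
  "dirichlet_solution \<Omega> s z u \<longleftrightarrow>
     u \<in> frac_sobolev0 \<Omega> s 2 \<and> (\<forall>v\<in>frac_sobolev0 \<Omega> s 2. frac_laplacian_form s u v = z v)"

definition Linfty_norm :: "'a::euclidean_space set \<Rightarrow> ('a \<Rightarrow> real) \<Rightarrow> ennreal" where
  "Linfty_norm \<Omega> u = esssup (lebesgue_on \<Omega>) (\<lambda>x. ennreal \<bar>u x\<bar>)"

definition Linfty :: "'a::euclidean_space set \<Rightarrow> ('a \<Rightarrow> real) set" where
  "Linfty \<Omega> = {u \<in> borel_measurable (lebesgue_on \<Omega>). Linfty_norm \<Omega> u < \<infinity>}"

end

theory Submission
  imports Defs
begin

text \<open>Existence and uniqueness are Riesz representation in \<open>frac_sobolev0 \<Omega> s 2\<close>, which is complete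
  by a Poincare inequality and Fatou's lemma. Boundedness is Stampacchia's truncation argument: testing with
  the part \<open>v\<close> of \<open>u\<close> exceeding \<open>k\<close> in modulus, supported in \<open>A = {\<bar>u\<bar> > k}\<close>, bounds the energy of \<open>v\<close> by
  \<open>\<parallel>z\<parallel>\<close> times its \<open>(t, p')\<close>-norm. Since \<open>t < s\<close> and \<open>p' < 2\<close>, that norm is at most a constant times
  \<open>sqrt (energy v) * \<bar>A\<bar> powr (1/p' - 1/2)\<close>. No Sobolev embedding is needed: the elementary Faber--Krahn
  inequality \<open>\<integral>v\<^sup>2 \<le> C * \<bar>A\<bar> powr (2s/N) * energy v\<close> suffices, and the resulting exponent
  \<open>2s/N + 2/p' - 1\<close> exceeds 1 exactly when \<open>p > N/s\<close>.\<close>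

section \<open>Faber--Krahn inequality\<close>

text \<open>Functions equal almost everywhere are not identified, so the form is only positive
  semidefinite on \<open>frac_sobolev0 \<Omega> s 2\<close>. Riesz representation is therefore
  proved for a set of functions with a semidefinite form, and completeness enters only as a
  statement about sequences with a fixed geometric rate. The pairs \<open>(x, y)\<close> that meet
  the support of \<open>v\<close> form a set of infinite measure, so a small support alone does not
  control the \<open>(t, q)\<close>-energy. Young's inequality with a free parameter
  \<open>\<eta>\<close> bounds the integrand pointwise, with one kernel near the diagonal and
  another far from it. Optimizing \<open>\<eta>\<close> at the end gives the product
  \<open>m powr (1 - q/2) * e powr (q/2)\<close> that Hoelder's inequality would suggest. In the
  truncation step the form is at least a multiple of the energy \<open>e\<close> of
  \<open>v\<close>, while the pairing grows like \<open>sqrt e\<close>. Cancelling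
  \<open>sqrt e\<close> makes \<open>e\<close> quadratic in the norm of \<open>z\<close>. With
  Chebyshev this is a decay of level sets with power \<open>\<beta>\<close> and factor
  \<open>1 / (h - k)\<^sup>2\<close>. For \<open>\<beta> > 1\<close> the level sets become null at a
  finite level \<open>d\<close>, and the condition on \<open>d\<^sup>2\<close> is proportional to
  the squared norm of \<open>z\<close>. This is why the final estimate is linear in
  \<open>z\<close>.\<close>

lemma sigma_finite_lebesgue: "sigma_finite_measure (lebesgue :: 'a::euclidean_space measure)"
proof
  show "\<exists>A::'a set set. countable A \<and> A \<subseteq> sets lebesgue \<and> \<Union>A = space lebesgue \<and>
      (\<forall>a\<in>A. emeasure lebesgue a \<noteq> \<infinity>)"
  proof -
    obtain A :: "'a set set" where A: "countable A" "A \<subseteq> sets lborel" "\<Union>A = space lborel"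
        "\<forall>a\<in>A. emeasure lborel a \<noteq> \<infinity>"
      using sigma_finite_measure.sigma_finite_countable[OF sigma_finite_lborel] by blast
    then show ?thesis
      by (intro exI[of _ A]) (auto intro!: sets_completionI_sets)
  qed
qed

interpretation lebesgue_pair: pair_sigma_finite
  "lebesgue :: 'a::euclidean_space measure" "lebesgue :: 'a measure"
  by (intro pair_sigma_finite.intro sigma_finite_lebesgue)

lemma measurable_dist_lebesgue [measurable]:
  "(\<lambda>p. dist (fst p) (snd p)) \<in> borel_measurable (lebesgue \<Otimes>\<^sub>M (lebesgue :: 'a::euclidean_space measure))"
proof (rule borel_measurable_dist)
  show "fst \<in> borel_measurable (lebesgue \<Otimes>\<^sub>M (lebesgue :: 'a measure))"
    by (rule measurable_compose[OF measurable_fst, of "\<lambda>x. x", simplified]) (auto intro: measurable_completion)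
  show "snd \<in> borel_measurable (lebesgue \<Otimes>\<^sub>M (lebesgue :: 'a measure))"
    by (rule measurable_compose[OF measurable_snd, of "\<lambda>x. x", simplified]) (auto intro: measurable_completion)
qed

lemma measurable_dist_lebesgue' [measurable]:
  "dist (x::'a::euclidean_space) \<in> borel_measurable lebesgue"
  by (intro measurable_completion) measurable

lemma gagliardo_energy_iterated:
  fixes u :: "'a::euclidean_space \<Rightarrow> real"
  assumes [measurable]: "u \<in> borel_measurable lebesgue"
  shows "gagliardo_energy \<sigma> q u =
    (\<integral>\<^sup>+ x. \<integral>\<^sup>+ y. ennreal (\<bar>u x - u y\<bar> powr q / dist x y powr (real DIM('a) + \<sigma> * q)) \<partial>lebesgue \<partial>lebesgue)"
  unfolding gagliardo_energy_def
  by (subst sigma_finite_measure.nn_integral_fst[OF sigma_finite_lebesgue, symmetric]) (auto simp: split_beta)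

lemma sets_lebesgue_Collect:
  "Measurable.pred lebesgue P \<Longrightarrow> {x::'a::euclidean_space. P x} \<in> sets lebesgue"
  by (simp add: pred_def)

lemma powr_abs_two: "\<bar>a::real\<bar> powr 2 = a\<^sup>2"
  by (simp add: powr_numeral)

text \<open>In a ball of volume \<open>2 m\<close> around a point of the support, \<open>v\<close> vanishes on at least half of the volume.\<close>

lemma faber_krahn:
  fixes v :: "'a::euclidean_space \<Rightarrow> real"
  assumes [measurable]: "v \<in> borel_measurable lebesgue" and "0 \<le> s" "0 < m"
    and supp: "emeasure lebesgue {x. v x \<noteq> 0} \<le> ennreal m"
  defines "\<omega> \<equiv> unit_ball_vol (real DIM('a))"
  shows "(\<integral>\<^sup>+ x. ennreal ((v x)\<^sup>2) \<partial>lebesgue) \<le>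
           ennreal (2 / \<omega> * (2 * m / \<omega>) powr (2 * s / real DIM('a))) * gagliardo_energy s 2 v"
proof -
  let ?N = "real DIM('a)"
  define R where "R = (2 * m / \<omega>) powr (1 / ?N)"
  have \<omega>: "\<omega> > 0" unfolding \<omega>_def by (rule unit_ball_vol_pos) simp
  have R: "R > 0" using \<omega> \<open>0 < m\<close> by (simp add: R_def)
  have RN: "\<omega> * R ^ DIM('a) = 2 * m"
    using R \<omega> \<open>0 < m\<close> by (simp add: R_def powr_power)
  have vol: "emeasure lebesgue (ball x R) = ennreal (2 * m)" for x :: 'a
    using R RN by (simp add: emeasure_ball \<omega>_def)
  have [measurable]: "{y. v y \<noteq> 0} \<in> sets lebesgue" "ball x R \<in> sets lebesgue" for x :: 'a
    by (auto intro: sets_lebesgue_Collect)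
  \<comment> \<open>The product of the volume \<open>m\<close> on which \<open>v\<close> surely
    vanishes inside the ball and the least value \<open>1 / R powr (N + 2 s)\<close> of the kernel
    there. Around every point \<open>x\<close> of the support the inner integral is at least
    \<open>c * (v x)\<^sup>2\<close>.\<close>
  define c where "c = m / R powr (?N + 2 * s)"
  have c: "c > 0" using R \<open>0 < m\<close> by (simp add: c_def)
  have inner: "ennreal (c * (v x)\<^sup>2) \<le>
     (\<integral>\<^sup>+ y. ennreal (\<bar>v x - v y\<bar> powr 2 / dist x y powr (?N + s * 2)) \<partial>lebesgue)" for x
  proof (cases "v x = 0")
    case False
    let ?D = "ball x R - {y. v y \<noteq> 0}"
    have "ennreal (2 * m) \<le> emeasure lebesgue (?D \<union> {y. v y \<noteq> 0})"
      unfolding vol[of x, symmetric] by (rule emeasure_mono) auto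
    also have "\<dots> \<le> emeasure lebesgue ?D + emeasure lebesgue {y. v y \<noteq> 0}"
      by (rule emeasure_subadditive) auto
    also have "\<dots> \<le> emeasure lebesgue ?D + ennreal m"
      using supp by (rule add_left_mono)
    finally have "ennreal m \<le> emeasure lebesgue ?D"
      using \<open>0 < m\<close> by (cases "emeasure lebesgue ?D") (auto simp flip: ennreal_plus)
    then have "ennreal ((v x)\<^sup>2 / R powr (?N + 2 * s)) * ennreal m \<le>
        ennreal ((v x)\<^sup>2 / R powr (?N + 2 * s)) * emeasure lebesgue ?D"
      by (rule mult_left_mono) simp
    moreover have "ennreal ((v x)\<^sup>2 / R powr (?N + 2 * s)) * ennreal m = ennreal (c * (v x)\<^sup>2)"
      using \<open>0 < m\<close> R by (simp add: c_def mult.commute flip: ennreal_mult')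
    ultimately have "ennreal (c * (v x)\<^sup>2) \<le> ennreal ((v x)\<^sup>2 / R powr (?N + 2 * s)) * emeasure lebesgue ?D"
      by simp
    also have "\<dots> = (\<integral>\<^sup>+ y. ennreal ((v x)\<^sup>2 / R powr (?N + 2 * s)) * indicator ?D y \<partial>lebesgue)"
      by (simp add: nn_integral_cmult_indicator)
    also have "\<dots> \<le> (\<integral>\<^sup>+ y. ennreal (\<bar>v x - v y\<bar> powr 2 / dist x y powr (?N + s * 2)) \<partial>lebesgue)"
    proof (rule nn_integral_mono)
      fix y :: 'a
      show "ennreal ((v x)\<^sup>2 / R powr (?N + 2 * s)) * indicator ?D y \<le>
        ennreal (\<bar>v x - v y\<bar> powr 2 / dist x y powr (?N + s * 2))"
      proof (cases "y \<in> ?D")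
        case True
        then have "dist x y > 0" using False by auto
        moreover have "dist x y powr (?N + 2 * s) \<le> R powr (?N + 2 * s)"
          using True \<open>0 \<le> s\<close> by (intro powr_mono2) auto
        ultimately show ?thesis using True
          using R by (auto simp: powr_abs_two mult.commute intro!: ennreal_leI divide_left_mono mult_pos_pos)
      qed auto
    qed
    finally show ?thesis .
  qed auto
  have "(\<integral>\<^sup>+ x. ennreal ((v x)\<^sup>2) \<partial>lebesgue) = (\<integral>\<^sup>+ x. ennreal (1 / c) * ennreal (c * (v x)\<^sup>2) \<partial>lebesgue)"
    using c by (simp add: ennreal_mult'[symmetric])
  also have "\<dots> = ennreal (1 / c) * (\<integral>\<^sup>+ x. ennreal (c * (v x)\<^sup>2) \<partial>lebesgue)"
    by (rule nn_integral_cmult) measurable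
  also have "\<dots> \<le> ennreal (1 / c) * gagliardo_energy s 2 v"
    unfolding gagliardo_energy_iterated[OF assms(1)] by (intro mult_left_mono nn_integral_mono inner) simp
  also have "1 / c = 2 / \<omega> * (2 * m / \<omega>) powr (2 * s / ?N)"
  proof -
    have "1 / c = R powr ?N / m * R powr (2 * s)" using R by (simp add: c_def powr_add)
    also have "R powr ?N = 2 * m / \<omega>" using RN \<omega> R by (simp add: powr_realpow field_simps)
    also have "R powr (2 * s) = (2 * m / \<omega>) powr (2 * s / ?N)" by (simp add: R_def powr_powr)
    finally show ?thesis using \<open>0 < m\<close> by simp
  qed
  finally show ?thesis .
qed

section \<open>Embedding into spaces of lower order\<close>

lemma term_le_suminf_ennreal: "f k \<le> (\<Sum>k. f k :: ennreal)"
  using sum_le_suminf[of f "{k}"] by simp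

text \<open>The kernel is dominated by multiples of indicators of dyadic balls: radii
  \<open>2 powr (-k)\<close> near \<open>x\<close>, radii \<open>2 powr (k + 1)\<close> far away.
  The resulting geometric series have ratios \<open>2 powr (-\<gamma>)\<close> and
  \<open>2 powr (-\<tau>)\<close>, so positivity of the two exponents is what makes them converge.
  Translation invariance of ball volumes makes the bound uniform in \<open>x\<close>.\<close>

lemma kernel_integrable:
  assumes "0 < \<gamma>" "0 < \<tau>"
  obtains C where "C > 0"
    "\<And>x :: 'a::euclidean_space. (\<integral>\<^sup>+ y. ennreal (if dist x y \<le> 1 then dist x y powr (\<gamma> - real DIM('a))
        else dist x y powr (- real DIM('a) - \<tau>)) \<partial>lebesgue) \<le> ennreal C"
proof -
  let ?N = "real DIM('a)"
  define \<omega> where "\<omega> = unit_ball_vol ?N"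
  have \<omega>: "\<omega> > 0" unfolding \<omega>_def by (rule unit_ball_vol_pos) simp
  \<comment> \<open>For \<open>2 powr (-k-1) < r \<le> 2 powr (-k)\<close> the factors
    \<open>r powr \<gamma>\<close> and \<open>r powr (-N)\<close> are bounded separately, the first
    at the outer and the second at the inner radius. This costs \<open>2 powr N\<close> but avoids a
    case distinction on the sign of \<open>\<gamma> - N\<close>.\<close>
  define a :: "nat \<Rightarrow> real" where "a k = 2 powr (?N + real k * (?N - \<gamma>))" for k
  define b :: "nat \<Rightarrow> real" where "b k = 2 powr (- real k * (?N + \<tau>))" for k
  define C\<^sub>1 where "C\<^sub>1 = (\<Sum>k. \<omega> * 2 powr ?N * (2 powr (-\<gamma>)) ^ k)"
  define C\<^sub>2 where "C\<^sub>2 = (\<Sum>k. \<omega> * 2 powr ?N * (2 powr (-\<tau>)) ^ k)"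
  have lt1: "2 powr (-\<gamma>) < 1" "2 powr (-\<tau>) < (1::real)"
    using assms by (auto simp: powr_less_one)
  have summ: "summable (\<lambda>k. \<omega> * 2 powr ?N * (2 powr (-\<gamma>)) ^ k)" "summable (\<lambda>k. \<omega> * 2 powr ?N * (2 powr (-\<tau>)) ^ k)"
    using lt1 by (auto intro!: summable_mult summable_geometric)
  have pos: "C\<^sub>1 \<ge> 0" "C\<^sub>2 \<ge> 0" using \<omega> by (auto simp: C\<^sub>1_def C\<^sub>2_def intro!: suminf_nonneg summ)
  have vol: "emeasure lborel (cball x r) = ennreal (\<omega> * r powr ?N)" if "r > 0" for x :: 'a and r
    using that by (simp add: emeasure_cball \<omega>_def powr_realpow)
  let ?w = "\<lambda>x y :: 'a. if dist x y \<le> 1 then dist x y powr (\<gamma> - ?N) else dist x y powr (- ?N - \<tau>)"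
  let ?f = "\<lambda>x k y. ennreal (a k) * indicator (cball x (2 powr - real k)) y"
  let ?g = "\<lambda>x k y. ennreal (b k) * indicator (cball x (2 powr (real k + 1))) y"
  have bound: "ennreal (?w x y) \<le> (\<Sum>k. ?f x k y) + (\<Sum>k. ?g x k y)" for x y :: 'a
  \<comment> \<open>On the diagonal the kernel is 0, because \<open>0 powr c = 0\<close>.\<close>
  proof (cases "x = y")
    case False
    let ?r = "dist x y"
    have r: "?r > 0" using False by simp
    show ?thesis
    proof (cases "?r \<le> 1")
      case True
      define k where "k = nat \<lfloor>- log 2 ?r\<rfloor>"
      have "0 \<le> - log 2 ?r" using r True by simp
      then have k: "real k \<le> - log 2 ?r" "- log 2 ?r < real k + 1"
        by (simp_all add: k_def)
      have "?r powr (\<gamma> - ?N) = 2 powr (log 2 ?r * (\<gamma> - ?N))"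
        using r by (simp add: powr_powr[symmetric])
      also have "\<dots> \<le> a k"
      proof -
        have "log 2 ?r * \<gamma> \<le> - real k * \<gamma>" using k assms by (intro mult_right_mono) auto
        moreover have "- log 2 ?r * ?N \<le> (real k + 1) * ?N" using k by (intro mult_right_mono) auto
        ultimately show ?thesis unfolding a_def by (intro powr_mono) (auto simp: algebra_simps)
      qed
      finally have "ennreal (?w x y) \<le> ennreal (a k)" using True by (simp add: ennreal_leI)
      moreover have "y \<in> cball x (2 powr - real k)"
      proof -
        have "?r = 2 powr (log 2 ?r)" using r by simp
        also have "\<dots> \<le> 2 powr - real k" using k by (intro powr_mono) auto
        finally show ?thesis by simp
      qed
      ultimately have "ennreal (?w x y) \<le> ?f x k y" by simp
      also have "\<dots> \<le> (\<Sum>k. ?f x k y)"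
        by (rule term_le_suminf_ennreal)
      also have "\<dots> \<le> (\<Sum>k. ?f x k y) + (\<Sum>k. ?g x k y)" by simp
      finally show ?thesis .
    next
      case far: False
      define k where "k = nat \<lfloor>log 2 ?r\<rfloor>"
      have "0 \<le> log 2 ?r" using r far by simp
      then have k: "real k \<le> log 2 ?r" "log 2 ?r \<le> real k + 1"
        by (simp_all add: k_def)
      have "?r powr (- ?N - \<tau>) = 2 powr (log 2 ?r * (- ?N - \<tau>))"
        using r by (simp add: powr_powr[symmetric])
      also have "\<dots> \<le> b k"
      proof -
        have "real k * (?N + \<tau>) \<le> log 2 ?r * (?N + \<tau>)" using k assms by (intro mult_right_mono) auto
        then show ?thesis unfolding b_def by (intro powr_mono) (auto simp: algebra_simps)
      qed
      finally have "ennreal (?w x y) \<le> ennreal (b k)" using far by (simp add: ennreal_leI)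
      moreover have "y \<in> cball x (2 powr (real k + 1))"
      proof -
        have "?r = 2 powr (log 2 ?r)" using r by simp
        also have "\<dots> \<le> 2 powr (real k + 1)" using k by (intro powr_mono) auto
        finally show ?thesis by simp
      qed
      ultimately have "ennreal (?w x y) \<le> ?g x k y" by simp
      also have "\<dots> \<le> (\<Sum>k. ?g x k y)"
        by (rule term_le_suminf_ennreal)
      also have "\<dots> \<le> (\<Sum>k. ?f x k y) + (\<Sum>k. ?g x k y)" by simp
      finally show ?thesis .
    qed
  qed simp
  have cb [measurable]: "cball x r \<in> sets lebesgue" for x :: 'a and r by simp
  \<comment> \<open>The summand 1 only makes the constant visibly positive.\<close>
  have "(\<integral>\<^sup>+ y. ennreal (?w x y) \<partial>lebesgue) \<le> ennreal (C\<^sub>1 + C\<^sub>2 + 1)" for x :: 'a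
  proof -
    have "(\<integral>\<^sup>+ y. ennreal (?w x y) \<partial>lebesgue) \<le> (\<integral>\<^sup>+ y. (\<Sum>k. ?f x k y) + (\<Sum>k. ?g x k y) \<partial>lebesgue)"
      by (intro nn_integral_mono bound)
    also have "\<dots> = (\<Sum>k. \<integral>\<^sup>+ y. ?f x k y \<partial>lebesgue) + (\<Sum>k. \<integral>\<^sup>+ y. ?g x k y \<partial>lebesgue)"
      by (simp add: nn_integral_add nn_integral_suminf)
    also have "(\<lambda>k. \<integral>\<^sup>+ y. ?f x k y \<partial>lebesgue) = (\<lambda>k. ennreal (\<omega> * 2 powr ?N * (2 powr (-\<gamma>)) ^ k))"
    proof
      fix k
      have "a k * (\<omega> * (2 powr - real k) powr ?N) = \<omega> * 2 powr ?N * (2 powr (-\<gamma>)) ^ k"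
        by (simp add: a_def powr_powr powr_power powr_add[symmetric] algebra_simps)
      then show "(\<integral>\<^sup>+ y. ?f x k y \<partial>lebesgue) = ennreal (\<omega> * 2 powr ?N * (2 powr (-\<gamma>)) ^ k)"
        using \<omega> by (simp add: nn_integral_cmult_indicator vol a_def flip: ennreal_mult)
    qed
    also have "(\<lambda>k. \<integral>\<^sup>+ y. ?g x k y \<partial>lebesgue) = (\<lambda>k. ennreal (\<omega> * 2 powr ?N * (2 powr (-\<tau>)) ^ k))"
    proof
      fix k
      have "b k * (\<omega> * (2 powr (real k + 1)) powr ?N) = \<omega> * 2 powr ?N * (2 powr (-\<tau>)) ^ k"
        by (simp add: b_def powr_powr powr_power powr_add[symmetric] algebra_simps)
      then show "(\<integral>\<^sup>+ y. ?g x k y \<partial>lebesgue) = ennreal (\<omega> * 2 powr ?N * (2 powr (-\<tau>)) ^ k)"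
        using \<omega> by (simp add: nn_integral_cmult_indicator vol b_def flip: ennreal_mult)
    qed
    also have "(\<Sum>k. ennreal (\<omega> * 2 powr ?N * (2 powr (-\<gamma>)) ^ k)) + (\<Sum>k. ennreal (\<omega> * 2 powr ?N * (2 powr (-\<tau>)) ^ k))
      = ennreal C\<^sub>1 + ennreal C\<^sub>2"
      unfolding C\<^sub>1_def C\<^sub>2_def using \<omega> by (intro arg_cong2[where f = "(+)"] suminf_ennreal2 summ) auto
    also have "\<dots> \<le> ennreal (C\<^sub>1 + C\<^sub>2 + 1)"
      using pos by (simp flip: ennreal_plus)
    finally show ?thesis .
  qed
  moreover have "C\<^sub>1 + C\<^sub>2 + 1 > 0" using pos by simp
  ultimately show ?thesis by (rule that[rotated])
qed

text \<open>Weighted arithmetic-geometric mean of \<open>\<eta> * a\<^sup>2\<close> and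
  \<open>\<eta> powr (-\<kappa>)\<close> with weights \<open>q/2\<close> and \<open>1 - q/2\<close>.
  The exponent \<open>\<kappa> = q / (2 - q)\<close> is the one for which \<open>\<eta>\<close>
  cancels in the product. The weights are then estimated by 1.\<close>

lemma young_powr:
  fixes a :: real
  assumes "0 < q" "q < 2" "0 < \<eta>" "0 \<le> a"
  shows "a powr q \<le> \<eta> * a\<^sup>2 + \<eta> powr (- (q / (2 - q)))"
proof (cases "a = 0")
  case False
  then have a: "a > 0" using assms by simp
  let ?\<kappa> = "q / (2 - q)"
  have "a powr q = (\<eta> * a\<^sup>2) powr (q / 2) * (\<eta> powr (- ?\<kappa>)) powr (1 - q / 2)"
  proof -
    have "(\<eta> * a\<^sup>2) powr (q / 2) = \<eta> powr (q / 2) * a powr q"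
      using a assms by (simp add: powr_mult powr_powr flip: powr_numeral)
    moreover have "?\<kappa> * (1 - q / 2) = q / 2" using assms by (simp add: field_simps)
    then have "(\<eta> powr (- ?\<kappa>)) powr (1 - q / 2) = \<eta> powr (- (q / 2))"
      by (simp only: powr_powr mult_minus_left)
    ultimately show ?thesis using assms by (simp add: powr_minus)
  qed
  also have "\<dots> \<le> q / 2 * (\<eta> * a\<^sup>2) + (1 - q / 2) * \<eta> powr (- ?\<kappa>)"
    using assms a by (intro Youngs_inequality_0) auto
  also have "\<dots> \<le> 1 * (\<eta> * a\<^sup>2) + 1 * \<eta> powr (- ?\<kappa>)"
    using assms by (intro add_mono mult_right_mono) auto
  finally show ?thesis by simp
qed (use assms in simp)

text \<open>This is \<open>young_powr\<close> with the position-dependent parameter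
  \<open>\<eta> * r powr (t * q - s * 2)\<close>, chosen so that the quadratic term carries exactly
  the kernel of order \<open>s\<close>. The remainder is \<open>r powr (\<gamma> - N)\<close> with
  \<open>\<gamma> = 2 q (s - t) / (2 - q)\<close>. For \<open>t < s\<close> this is integrable near
  the diagonal: the surplus of smoothness pays for the smaller exponent.\<close>

lemma young_scaled:
  fixes a r N :: real
  assumes "0 < q" "q < 2" "0 < \<eta>" "0 \<le> a" "0 < r"
  shows "a powr q / r powr (N + t * q) \<le>
    \<eta> * (a\<^sup>2 / r powr (N + s * 2)) + \<eta> powr (- (q / (2 - q))) * r powr ((s - t) * 2 * q / (2 - q) - N)"
proof -
  define \<kappa> where "\<kappa> = q / (2 - q)"
  have e: "(s - t) * 2 * q / (2 - q) - N = (t * q - s * 2) * - \<kappa> - (N + t * q)"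
    using assms by (simp add: \<kappa>_def field_simps)
  have "a powr q \<le> (\<eta> * r powr (t * q - s * 2)) * a\<^sup>2 + (\<eta> * r powr (t * q - s * 2)) powr (- \<kappa>)"
    unfolding \<kappa>_def using assms by (intro young_powr) auto
  also have "(\<eta> * r powr (t * q - s * 2)) powr (- \<kappa>) = \<eta> powr (- \<kappa>) * r powr ((t * q - s * 2) * - \<kappa>)"
    using assms by (simp add: powr_mult powr_powr)
  finally have "a powr q / r powr (N + t * q) \<le>
    ((\<eta> * r powr (t * q - s * 2)) * a\<^sup>2 + \<eta> powr (- \<kappa>) * r powr ((t * q - s * 2) * - \<kappa>)) / r powr (N + t * q)"
    by (rule divide_right_mono) simp
  also have "\<dots> = \<eta> * a\<^sup>2 * (r powr (t * q - s * 2) / r powr (N + t * q)) +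
      \<eta> powr (- \<kappa>) * (r powr ((t * q - s * 2) * - \<kappa>) / r powr (N + t * q))"
    by (simp add: add_divide_distrib)
  also have "r powr (t * q - s * 2) / r powr (N + t * q) = 1 / r powr (N + s * 2)"
    using assms by (simp add: powr_diff powr_add powr_minus field_simps)
  also have "r powr ((t * q - s * 2) * - \<kappa>) / r powr (N + t * q) = r powr ((s - t) * 2 * q / (2 - q) - N)"
    unfolding e by (rule powr_diff[symmetric])
  finally show ?thesis by (simp add: \<kappa>_def)
qed

text \<open>By Tonelli, each summand is integrated first in the variable on which \<open>f\<close>
  does not depend. Symmetry of \<open>w\<close> makes the bound on the integral in \<open>y\<close>
  serve for both.\<close>

lemma nn_integral_symmetric_kernel:
  fixes w :: "'a::euclidean_space \<Rightarrow> 'a \<Rightarrow> ennreal"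
  assumes [measurable]: "(\<lambda>p. w (fst p) (snd p)) \<in> borel_measurable (lebesgue \<Otimes>\<^sub>M lebesgue)"
    and sym: "\<And>x y. w x y = w y x"
    and bound: "\<And>x. (\<integral>\<^sup>+ y. w x y \<partial>lebesgue) \<le> C"
    and [measurable]: "f \<in> borel_measurable lebesgue"
  shows "(\<integral>\<^sup>+ p. (f (fst p) + f (snd p)) * w (fst p) (snd p) \<partial>(lebesgue \<Otimes>\<^sub>M lebesgue)) \<le> 2 * C * (\<integral>\<^sup>+ x. f x \<partial>lebesgue)"
proof -
  have [measurable]: "w x \<in> borel_measurable lebesgue" for x
    using measurable_compose_Pair1[OF _ assms(1), of x] by simp
  have le: "(\<integral>\<^sup>+ x. \<integral>\<^sup>+ y. f x * w x y \<partial>lebesgue \<partial>lebesgue) \<le> C * (\<integral>\<^sup>+ x. f x \<partial>lebesgue)"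
  proof -
    have "(\<integral>\<^sup>+ x. \<integral>\<^sup>+ y. f x * w x y \<partial>lebesgue \<partial>lebesgue) = (\<integral>\<^sup>+ x. f x * (\<integral>\<^sup>+ y. w x y \<partial>lebesgue) \<partial>lebesgue)"
      by (simp add: nn_integral_cmult)
    also have "\<dots> \<le> (\<integral>\<^sup>+ x. f x * C \<partial>lebesgue)"
      by (intro nn_integral_mono mult_left_mono bound) simp
    also have "\<dots> = (\<integral>\<^sup>+ x. f x \<partial>lebesgue) * C"
      by (rule nn_integral_multc) measurable
    finally show ?thesis by (simp add: mult.commute)
  qed
  have "(\<integral>\<^sup>+ p. (f (fst p) + f (snd p)) * w (fst p) (snd p) \<partial>(lebesgue \<Otimes>\<^sub>M lebesgue)) =
     (\<integral>\<^sup>+ p. f (fst p) * w (fst p) (snd p) \<partial>(lebesgue \<Otimes>\<^sub>M lebesgue)) +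
     (\<integral>\<^sup>+ p. f (snd p) * w (fst p) (snd p) \<partial>(lebesgue \<Otimes>\<^sub>M lebesgue))"
    by (simp add: distrib_right nn_integral_add)
  also have "(\<integral>\<^sup>+ p. f (fst p) * w (fst p) (snd p) \<partial>(lebesgue \<Otimes>\<^sub>M lebesgue)) =
      (\<integral>\<^sup>+ x. \<integral>\<^sup>+ y. f x * w x y \<partial>lebesgue \<partial>lebesgue)"
    by (subst sigma_finite_measure.nn_integral_fst[OF sigma_finite_lebesgue, symmetric]) simp_all
  also have "(\<integral>\<^sup>+ p. f (snd p) * w (fst p) (snd p) \<partial>(lebesgue \<Otimes>\<^sub>M lebesgue)) =
      (\<integral>\<^sup>+ y. \<integral>\<^sup>+ x. f y * w y x \<partial>lebesgue \<partial>lebesgue)"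
    by (subst lebesgue_pair.nn_integral_snd[symmetric]) (simp_all add: split_beta sym)
  also have "(\<integral>\<^sup>+ x. \<integral>\<^sup>+ y. f x * w x y \<partial>lebesgue \<partial>lebesgue) + (\<integral>\<^sup>+ y. \<integral>\<^sup>+ x. f y * w y x \<partial>lebesgue \<partial>lebesgue)
      \<le> C * (\<integral>\<^sup>+ x. f x \<partial>lebesgue) + C * (\<integral>\<^sup>+ x. f x \<partial>lebesgue)"
    by (intro add_mono le)
  finally show ?thesis by (simp add: mult_2 distrib_right)
qed

text \<open>Near the diagonal the scaled Young inequality applies, far from it the unscaled one. In
  both regions what is not part of the \<open>s\<close>-energy is charged to a function
  \<open>f\<close> of a single variable times an integrable kernel. The parameter
  \<open>\<eta>\<close> stays free, to be balanced against the energy and the size of the support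
  later.\<close>

lemma gagliardo_energy_embedding:
  assumes "1 \<le> q" "q < 2" "0 < t" "t < s"
  obtains C where "C > 0"
    "\<And>(v :: 'a::euclidean_space \<Rightarrow> real) m \<eta>. v \<in> borel_measurable lebesgue \<Longrightarrow>
       emeasure lebesgue {x. v x \<noteq> 0} \<le> ennreal m \<Longrightarrow> 0 < \<eta> \<Longrightarrow> 0 < m \<Longrightarrow>
       gagliardo_energy t q v \<le> ennreal \<eta> * (gagliardo_energy s 2 v + ennreal C * (\<integral>\<^sup>+ x. ennreal ((v x)\<^sup>2) \<partial>lebesgue))
         + ennreal (C * \<eta> powr (- (q / (2 - q))) * m)"
proof -
  let ?N = "real DIM('a)" and ?\<kappa> = "q / (2 - q)" and ?\<gamma> = "(s - t) * 2 * q / (2 - q)"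
  have "0 < ?\<gamma>" "0 < t * q" using assms by auto
  then obtain C where C: "C > 0"
    "\<And>x :: 'a. (\<integral>\<^sup>+ y. ennreal (if dist x y \<le> 1 then dist x y powr (?\<gamma> - ?N)
        else dist x y powr (- ?N - t * q)) \<partial>lebesgue) \<le> ennreal C"
    using kernel_integrable[where 'a = 'a, of ?\<gamma> "t * q"] by blast
  define w where "w x y = (if dist x y \<le> 1 then dist x y powr (?\<gamma> - ?N)
        else dist x y powr (- ?N - t * q))" for x y :: 'a
  have w: "w x y \<ge> 0" for x y by (simp add: w_def)
  have [measurable]: "(\<lambda>p. w (fst p) (snd p)) \<in> borel_measurable (lebesgue \<Otimes>\<^sub>M lebesgue)"
    unfolding w_def by measurable
  \<comment> \<open>The 4 is 2 from the symmetric kernel times 2 from the quadratic part of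
    \<open>f\<close>. In the last term 2 would do, but a single constant is kept.\<close>
  have est: "gagliardo_energy t q v \<le> ennreal \<eta> * (gagliardo_energy s 2 v + ennreal (4 * C) * (\<integral>\<^sup>+ x. ennreal ((v x)\<^sup>2) \<partial>lebesgue))
         + ennreal (4 * C * \<eta> powr (- ?\<kappa>) * m)"
    if [measurable]: "v \<in> borel_measurable lebesgue" and supp: "emeasure lebesgue {x. v x \<noteq> 0} \<le> ennreal m"
      and "0 < \<eta>" "0 < m" for v :: "'a \<Rightarrow> real" and m \<eta>
  proof -
    have [measurable]: "{x. v x \<noteq> 0} \<in> sets lebesgue" by (rule sets_lebesgue_Collect) measurable
    \<comment> \<open>If \<open>v x \<noteq> v y\<close>, at least one of the two points lies in the
      support, so one copy of \<open>\<eta> powr (-\<kappa>)\<close> is present in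
      \<open>f x + f y\<close>. The factor 2 comes from
      \<open>(a - b)\<^sup>2 \<le> 2 * (a\<^sup>2 + b\<^sup>2)\<close>.\<close>
    define f where "f x = 2 * \<eta> * (v x)\<^sup>2 + \<eta> powr (- ?\<kappa>) * indicator {x. v x \<noteq> 0} x" for x
    have f: "f x \<ge> 0" for x using \<open>0 < \<eta>\<close> by (simp add: f_def)
    have [measurable]: "f \<in> borel_measurable lebesgue" unfolding f_def by measurable
    have "\<bar>v x - v y\<bar> powr q / dist x y powr (?N + t * q) \<le>
       \<eta> * (\<bar>v x - v y\<bar> powr 2 / dist x y powr (?N + s * 2)) + (f x + f y) * w x y" for x y
    proof (cases "v x = v y")
      case False
      let ?a = "\<bar>v x - v y\<bar>" and ?r = "dist x y"
      have r: "?r > 0" using False by auto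
      have "f x + f y \<ge> 2 * \<eta> * ((v x)\<^sup>2 + (v y)\<^sup>2) + \<eta> powr (- ?\<kappa>)"
        using False by (cases "v x = 0") (auto simp: f_def algebra_simps)
      moreover have "2 * ((v x)\<^sup>2 + (v y)\<^sup>2) \<ge> (v x - v y)\<^sup>2"
        using zero_le_power2[of "v x + v y"] by (simp add: power2_eq_square algebra_simps)
      then have "\<eta> * (2 * ((v x)\<^sup>2 + (v y)\<^sup>2)) \<ge> \<eta> * (v x - v y)\<^sup>2"
        using \<open>0 < \<eta>\<close> by simp
      ultimately have ff: "f x + f y \<ge> \<eta> * ?a\<^sup>2 + \<eta> powr (- ?\<kappa>)" by (simp add: algebra_simps)
      show ?thesis
      proof (cases "?r \<le> 1")
        case True
        have "\<eta> powr (- ?\<kappa>) \<le> f x + f y" using ff \<open>0 < \<eta>\<close> by (smt (verit) mult_nonneg_nonneg zero_le_power2)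
        then have "\<eta> powr (- ?\<kappa>) * w x y \<le> (f x + f y) * w x y"
          using w by (rule mult_right_mono)
        moreover have "?a powr q / ?r powr (?N + t * q) \<le>
            \<eta> * (?a\<^sup>2 / ?r powr (?N + s * 2)) + \<eta> powr (- ?\<kappa>) * ?r powr (?\<gamma> - ?N)"
          using assms r \<open>0 < \<eta>\<close> by (intro young_scaled) auto
        ultimately show ?thesis using True by (simp add: w_def powr_abs_two)
      next
        \<comment> \<open>Here the scaled remainder \<open>r powr (\<gamma> - N)\<close> would not
          be integrable at infinity. The unscaled inequality is divided by
          \<open>r powr (N + t q)\<close> instead, and the whole right-hand side goes into
          \<open>f\<close>; the energy term is merely added.\<close>
        case far: False
        have "?a powr q \<le> \<eta> * ?a\<^sup>2 + \<eta> powr (- ?\<kappa>)"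
          using assms \<open>0 < \<eta>\<close> by (intro young_powr) auto
        also note ff
        finally have "?a powr q * w x y \<le> (f x + f y) * w x y"
          using w by (intro mult_right_mono) auto
        moreover have "w x y = 1 / ?r powr (?N + t * q)"
          using far r by (simp add: w_def powr_minus_divide[symmetric])
        moreover have "0 \<le> \<eta> * (?a powr 2 / ?r powr (?N + s * 2))" using \<open>0 < \<eta>\<close> by simp
        ultimately show ?thesis by simp
      qed
    qed (use f w in simp)
    then have pw: "ennreal (\<bar>v x - v y\<bar> powr q / dist x y powr (?N + t * q)) \<le>
       ennreal \<eta> * ennreal (\<bar>v x - v y\<bar> powr 2 / dist x y powr (?N + s * 2)) +
       (ennreal (f x) + ennreal (f y)) * ennreal (w x y)" for x y
      using f w \<open>0 < \<eta>\<close>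
      by (simp flip: ennreal_plus ennreal_mult ennreal_mult')
    have intf: "(\<integral>\<^sup>+ x. ennreal (f x) \<partial>lebesgue) \<le>
        ennreal (2 * \<eta>) * (\<integral>\<^sup>+ x. ennreal ((v x)\<^sup>2) \<partial>lebesgue) + ennreal (\<eta> powr (- ?\<kappa>) * m)"
    proof -
      have "(\<integral>\<^sup>+ x. ennreal (f x) \<partial>lebesgue) = (\<integral>\<^sup>+ x. ennreal (2 * \<eta>) * ennreal ((v x)\<^sup>2)
          + ennreal (\<eta> powr (- ?\<kappa>)) * indicator {x. v x \<noteq> 0} x \<partial>lebesgue)"
        using \<open>0 < \<eta>\<close> by (intro nn_integral_cong) (auto simp: f_def ennreal_plus ennreal_mult split: split_indicator)
      also have "\<dots> = ennreal (2 * \<eta>) * (\<integral>\<^sup>+ x. ennreal ((v x)\<^sup>2) \<partial>lebesgue)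
          + ennreal (\<eta> powr (- ?\<kappa>)) * emeasure lebesgue {x. v x \<noteq> 0}"
        by (simp add: nn_integral_add nn_integral_cmult nn_integral_cmult_indicator)
      also have "\<dots> \<le> ennreal (2 * \<eta>) * (\<integral>\<^sup>+ x. ennreal ((v x)\<^sup>2) \<partial>lebesgue)
          + ennreal (\<eta> powr (- ?\<kappa>)) * ennreal m"
        by (intro add_left_mono mult_left_mono supp) simp
      finally show ?thesis using \<open>0 < m\<close> by (simp add: ennreal_mult)
    qed
    have "gagliardo_energy t q v \<le> (\<integral>\<^sup>+ p. ennreal \<eta> * (case p of (x, y) \<Rightarrow> ennreal (\<bar>v x - v y\<bar> powr 2 / dist x y powr (?N + s * 2))) +
       (ennreal (f (fst p)) + ennreal (f (snd p))) * ennreal (w (fst p) (snd p)) \<partial>(lebesgue \<Otimes>\<^sub>M lebesgue))"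
      unfolding gagliardo_energy_def by (intro nn_integral_mono) (simp only: split_paired_all case_prod_conv fst_conv snd_conv pw)
    also have "\<dots> = ennreal \<eta> * gagliardo_energy s 2 v +
      (\<integral>\<^sup>+ p. (ennreal (f (fst p)) + ennreal (f (snd p))) * ennreal (w (fst p) (snd p)) \<partial>(lebesgue \<Otimes>\<^sub>M lebesgue))"
      unfolding gagliardo_energy_def split_beta by (simp add: nn_integral_add nn_integral_cmult)
    also have "\<dots> \<le> ennreal \<eta> * gagliardo_energy s 2 v + 2 * ennreal C * (\<integral>\<^sup>+ x. ennreal (f x) \<partial>lebesgue)"
    proof (intro add_left_mono nn_integral_symmetric_kernel)
      show "(\<integral>\<^sup>+ y. ennreal (w x y) \<partial>lebesgue) \<le> ennreal C" for x
        unfolding w_def by (rule C)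
      show "ennreal (w x y) = ennreal (w y x)" for x y by (simp add: w_def dist_commute)
    qed measurable
    also have "\<dots> \<le> ennreal \<eta> * gagliardo_energy s 2 v + 2 * ennreal C *
        (ennreal (2 * \<eta>) * (\<integral>\<^sup>+ x. ennreal ((v x)\<^sup>2) \<partial>lebesgue) + ennreal (\<eta> powr (- ?\<kappa>) * m))"
      by (intro add_left_mono mult_left_mono intf) simp
    also have "\<dots> = ennreal \<eta> * (gagliardo_energy s 2 v + ennreal (4 * C) * (\<integral>\<^sup>+ x. ennreal ((v x)\<^sup>2) \<partial>lebesgue))
         + 2 * ennreal C * ennreal (\<eta> powr (- ?\<kappa>) * m)"
    proof -
      have "2 * ennreal C = ennreal (2 * C)" using C by (simp add: ennreal_mult)
      then have "2 * ennreal C * ennreal (2 * \<eta>) = ennreal (2 * C * (2 * \<eta>))"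
        using C \<open>0 < \<eta>\<close> by (simp only:) (intro ennreal_mult[symmetric]; simp)
      also have "\<dots> = ennreal (\<eta> * (4 * C))" by (simp add: mult_ac)
      also have "\<dots> = ennreal \<eta> * ennreal (4 * C)" using C \<open>0 < \<eta>\<close> by (intro ennreal_mult) auto
      finally show ?thesis by (simp only: distrib_left mult.assoc[symmetric] add.assoc)
    qed
    also have "2 * ennreal C * ennreal (\<eta> powr (- ?\<kappa>) * m) \<le> ennreal (4 * C * \<eta> powr (- ?\<kappa>) * m)"
    proof -
      have "2 * ennreal C * ennreal (\<eta> powr (- ?\<kappa>) * m) = ennreal (2 * C * (\<eta> powr (- ?\<kappa>) * m))"
        using C \<open>0 < m\<close> by (simp add: ennreal_mult)
      also have "\<dots> \<le> ennreal (4 * C * \<eta> powr (- ?\<kappa>) * m)"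
        using C \<open>0 < m\<close> by (intro ennreal_leI) (simp add: mult.assoc)
      finally show ?thesis .
    qed
    finally show ?thesis by (simp add: add_left_mono)
  qed
  have "4 * C > 0" using C by simp
  then show ?thesis using est by (rule that)
qed

section \<open>Riesz representation\<close>

text \<open>A minimizing sequence of \<open>b u u - 2 * z u\<close> is Cauchy by the parallelogram law.\<close>

lemma riesz_representation_functions:
  fixes H :: "('a \<Rightarrow> real) set" and b :: "('a \<Rightarrow> real) \<Rightarrow> ('a \<Rightarrow> real) \<Rightarrow> real"
  assumes zero: "(\<lambda>x. 0) \<in> H"
    and add: "\<And>u v. u \<in> H \<Longrightarrow> v \<in> H \<Longrightarrow> (\<lambda>x. u x + v x) \<in> H"
    and scale: "\<And>c u. u \<in> H \<Longrightarrow> (\<lambda>x. c * u x) \<in> H"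
    and b_add: "\<And>u v w. u \<in> H \<Longrightarrow> v \<in> H \<Longrightarrow> w \<in> H \<Longrightarrow> b (\<lambda>x. u x + v x) w = b u w + b v w"
    and b_scale: "\<And>c u v. u \<in> H \<Longrightarrow> v \<in> H \<Longrightarrow> b (\<lambda>x. c * u x) v = c * b u v"
    and b_sym: "\<And>u v. b u v = b v u"
    and b_pos: "\<And>u. u \<in> H \<Longrightarrow> 0 \<le> b u u"
    and complete: "\<And>w. (\<And>n::nat. w n \<in> H) \<Longrightarrow>
      (\<And>n k. n \<le> k \<Longrightarrow> b (\<lambda>x. w k x - w n x) (\<lambda>x. w k x - w n x) \<le> 4 * (1/4) ^ n) \<Longrightarrow>
      \<exists>u\<in>H. \<forall>n. b (\<lambda>x. u x - w n x) (\<lambda>x. u x - w n x) \<le> 4 * (1/4) ^ n"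
    and z_add: "\<And>u v. u \<in> H \<Longrightarrow> v \<in> H \<Longrightarrow> z (\<lambda>x. u x + v x) = z u + z v"
    and z_scale: "\<And>c u. u \<in> H \<Longrightarrow> z (\<lambda>x. c * u x) = c * z u"
    and z_bound: "\<And>u. u \<in> H \<Longrightarrow> \<bar>z u\<bar> \<le> B * sqrt (b u u)"
  obtains u where "u \<in> H" "\<And>v. v \<in> H \<Longrightarrow> b u v = z v"
proof -
  define J where "J u = b u u - 2 * z u" for u
  have b_add_right: "b w (\<lambda>x. u x + v x) = b w u + b w v" if "u \<in> H" "v \<in> H" "w \<in> H" for u v w
    using that by (simp add: b_sym[of w] b_add)
  have b_scale_right: "b v (\<lambda>x. c * u x) = c * b v u" if "u \<in> H" "v \<in> H" for c u v
    using that by (simp add: b_sym[of v] b_scale)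
  note bs = b_add b_scale b_add_right b_scale_right z_add z_scale add scale
  \<comment> \<open>Differences are rewritten as sums with a multiple, so that the rules in
    \<open>bs\<close> expand them.\<close>
  have diff: "(\<lambda>x. u x - v x) = (\<lambda>x. u x + (-1) * v x)" for u v :: "'a \<Rightarrow> real"
    by simp
  \<comment> \<open>Completing the square in \<open>sqrt (b u u)\<close>.\<close>
  have "- B\<^sup>2 \<le> J u" if "u \<in> H" for u
  proof -
    have "0 \<le> (sqrt (b u u) - B)\<^sup>2" by simp
    also have "\<dots> = b u u - 2 * (B * sqrt (b u u)) + B\<^sup>2"
      using b_pos[OF that] by (simp add: power2_diff)
    also have "\<dots> \<le> J u + B\<^sup>2" using z_bound[OF that] by (simp add: J_def)
    finally show ?thesis by simp
  qed
  then have bdd: "bdd_below (J ` H)" by (rule bdd_belowI2)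
  define m where "m = Inf (J ` H)"
  have m: "m \<le> J u" if "u \<in> H" for u
    unfolding m_def using bdd that by (intro cINF_lower)
  have "\<exists>u\<in>H. J u < m + (1/4) ^ n" for n
  proof -
    have "Inf (J ` H) < m + (1/4) ^ n" by (simp add: m_def)
    then show ?thesis using zero bdd by (subst (asm) cInf_less_iff) auto
  qed
  then obtain w where w: "\<And>n. w n \<in> H" "\<And>n. J (w n) < m + (1/4) ^ n" by metis
  have cauchy: "b (\<lambda>x. w k x - w n x) (\<lambda>x. w k x - w n x) \<le> 4 * (1/4) ^ n" if "n \<le> k" for n k
  proof -
    \<comment> \<open>In this form of the parallelogram law the linear parts of \<open>J\<close>
      cancel. The midpoint has \<open>J\<close> at least \<open>m\<close>, so only the defects
      \<open>(1/4) ^ k\<close> and \<open>(1/4) ^ n\<close> of the two near-minimizers survive, each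
      doubled.\<close>
    have "b (\<lambda>x. w k x - w n x) (\<lambda>x. w k x - w n x) =
        2 * J (w k) + 2 * J (w n) - 4 * J (\<lambda>x. (1/2) * (w k x + w n x))"
      unfolding diff J_def by (simp only: bs w) (simp add: b_sym[of "w n" "w k"] algebra_simps)
    also have "\<dots> \<le> 2 * (1/4) ^ k + 2 * (1/4) ^ n"
      using m[OF scale[OF add[OF w(1)[of k] w(1)[of n]], of "1/2"]] w(2)[of k] w(2)[of n] by simp
    also have "(1/4::real) ^ k \<le> (1/4) ^ n" using that by (intro power_decreasing) auto
    finally show ?thesis by simp
  qed
  obtain u where u: "u \<in> H" "\<And>n. b (\<lambda>x. u x - w n x) (\<lambda>x. u x - w n x) \<le> 4 * (1/4) ^ n"
    using complete[of w] w(1) cauchy by blast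
  have "b u v = z v" if v: "v \<in> H" for v
  proof -
    have bv: "b v v \<ge> 0" using b_pos v by simp
    have est: "\<bar>b u v - z v\<bar> \<le> (5 + 2 * b v v) * (1/2) ^ n" for n
    proof -
      \<comment> \<open>The square root of the defect of \<open>w n\<close>. A variation of size
        \<open>\<tau>\<close> in the direction \<open>v\<close> can lower \<open>J\<close> by less
        than \<open>\<tau> * \<tau>\<close>, hence the first variation at \<open>w n\<close> is of
        order \<open>\<tau>\<close>.\<close>
      define \<tau> where "\<tau> = (1/2::real) ^ n"
      have \<tau>: "\<tau> > 0" "(1/4) ^ n = \<tau> * \<tau>" by (auto simp: \<tau>_def power_mult_distrib[symmetric])
      have "2 * \<bar>b (w n) v - z v\<bar> \<le> \<tau> + \<tau> * b v v"
      proof -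
        have "- (\<tau> * \<tau>) \<le> 2 * (c * (b (w n) v - z v)) + c * c * b v v" for c
        proof -
          have "J (\<lambda>x. w n x + c * v x) = J (w n) + 2 * (c * (b (w n) v - z v)) + c * c * b v v"
            using w(1)[of n] v unfolding J_def
            by (simp only: bs) (simp add: b_sym[of v "w n"] algebra_simps)
          then show ?thesis
            using m[OF add[OF w(1)[of n] scale[OF v, of c]]] w(2)[of n] \<tau> by simp
        qed
        from this[of \<tau>] this[of "-\<tau>"]
        have "\<tau> * (2 * (b (w n) v - z v) + \<tau> * b v v + \<tau>) \<ge> 0" "\<tau> * (- 2 * (b (w n) v - z v) + \<tau> * b v v + \<tau>) \<ge> 0"
          by (simp_all add: algebra_simps)
        then show ?thesis using \<tau> by (simp add: zero_le_mult_iff abs_if)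
      qed
      moreover have "2 * \<bar>b u v - b (w n) v\<bar> \<le> 4 * \<tau> + \<tau> * b v v"
      proof -
        define d where "d = (\<lambda>x. u x - w n x)"
        have d: "d \<in> H" using u(1) w(1)[of n] unfolding d_def diff by (intro add scale)
        have "b u v - b (w n) v = b d v" using u(1) w(1)[of n] v unfolding d_def diff
          by (simp only: bs)
        \<comment> \<open>Nonnegativity of the form at \<open>d + c v\<close>, used for
          \<open>c\<close> equal to \<open>\<tau>\<close> and to \<open>-\<tau>\<close>, replaces
          the Cauchy-Schwarz inequality and matches the shape of the preceding estimate.\<close>
        moreover have "0 \<le> b d d + 2 * (c * b d v) + c * c * b v v" for c
        proof -
          have "b (\<lambda>x. d x + c * v x) (\<lambda>x. d x + c * v x) = b d d + 2 * (c * b d v) + c * c * b v v"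
            using d v by (simp only: bs) (simp add: b_sym[of v d] algebra_simps)
          then show ?thesis
            using b_pos[OF add[OF d scale[OF v, of c]]] by simp
        qed
        from this[of \<tau>] this[of "-\<tau>"] u(2)[of n]
        have "\<tau> * (2 * b d v + \<tau> * b v v + 4 * \<tau>) \<ge> 0" "\<tau> * (- 2 * b d v + \<tau> * b v v + 4 * \<tau>) \<ge> 0"
          unfolding \<tau> d_def[symmetric] by (simp_all add: algebra_simps)
        then have "2 * \<bar>b d v\<bar> \<le> 4 * \<tau> + \<tau> * b v v" using \<tau> by (simp add: zero_le_mult_iff abs_if)
        ultimately show ?thesis by simp
      qed
      moreover have "0 \<le> \<tau> * b v v" using \<tau> bv by simp
      moreover have "\<bar>b u v - z v\<bar> \<le> \<bar>b u v - b (w n) v\<bar> + \<bar>b (w n) v - z v\<bar>" by linarith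
      moreover have "C \<le> 5 * t + 2 * y" if "2 * A \<le> t + y" "2 * B \<le> 4 * t + y" "0 \<le> y" "C \<le> B + A" "0 < t"
        for A B C t y :: real
        using that by linarith
      ultimately have "\<bar>b u v - z v\<bar> \<le> 5 * \<tau> + 2 * (\<tau> * b v v)" using \<tau>(1) by blast
      also have "\<dots> = (5 + 2 * b v v) * \<tau>" by (simp add: algebra_simps)
      finally show ?thesis by (simp only: \<tau>_def)
    qed
    have "(\<lambda>n. (5 + 2 * b v v) * (1/2) ^ n) \<longlonglongrightarrow> (5 + 2 * b v v) * 0"
      by (intro tendsto_intros LIMSEQ_realpow_zero) auto
    then have "\<bar>b u v - z v\<bar> \<le> (5 + 2 * b v v) * 0"
      by (rule tendsto_lowerbound) (use est in auto)
    then show ?thesis by simp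
  qed
  with u(1) show ?thesis by (rule that)
qed

section \<open>Fractional Sobolev spaces and their duals\<close>

lemma measurable_gagliardo_integrand [measurable]:
  fixes u :: "'a::euclidean_space \<Rightarrow> real"
  assumes [measurable]: "u \<in> borel_measurable lebesgue"
  shows "(\<lambda>(x, y). ennreal (\<bar>u x - u y\<bar> powr q / dist x y powr c)) \<in> borel_measurable (lebesgue \<Otimes>\<^sub>M lebesgue)"
  unfolding split_beta by measurable

section \<open>Behaviour of the energy under contraction, scaling and addition\<close>

lemma gagliardo_energy_mono_scaled:
  fixes u v :: "'a::euclidean_space \<Rightarrow> real"
  assumes [measurable]: "u \<in> borel_measurable lebesgue" and "0 \<le> c" "0 \<le> q"
    and le: "\<And>x y. \<bar>v x - v y\<bar> \<le> c * \<bar>u x - u y\<bar>"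
  shows "gagliardo_energy \<sigma> q v \<le> ennreal (c powr q) * gagliardo_energy \<sigma> q u"
proof -
  have "ennreal (\<bar>v x - v y\<bar> powr q / dist x y powr k) \<le>
      ennreal (c powr q) * ennreal (\<bar>u x - u y\<bar> powr q / dist x y powr k)" for x y and k :: real
  proof -
    have "\<bar>v x - v y\<bar> powr q \<le> (c * \<bar>u x - u y\<bar>) powr q"
      using le[of x y] \<open>0 \<le> q\<close> by (intro powr_mono2) auto
    then show ?thesis using \<open>0 \<le> c\<close>
      by (simp add: powr_mult ennreal_leI divide_right_mono flip: ennreal_mult')
  qed
  then have "gagliardo_energy \<sigma> q v \<le> (\<integral>\<^sup>+ p. ennreal (c powr q) *
     (case p of (x, y) \<Rightarrow> ennreal (\<bar>u x - u y\<bar> powr q / dist x y powr (real DIM('a) + \<sigma> * q))) \<partial>(lebesgue \<Otimes>\<^sub>M lebesgue))"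
    unfolding gagliardo_energy_def by (intro nn_integral_mono) (auto simp: split_beta)
  also have "\<dots> = ennreal (c powr q) * gagliardo_energy \<sigma> q u"
    unfolding gagliardo_energy_def by (rule nn_integral_cmult) measurable
  finally show ?thesis .
qed

lemma gagliardo_energy_scale:
  fixes u :: "'a::euclidean_space \<Rightarrow> real"
  assumes [measurable]: "u \<in> borel_measurable lebesgue" and "0 < q"
  shows "gagliardo_energy \<sigma> q (\<lambda>x. c * u x) = ennreal (\<bar>c\<bar> powr q) * gagliardo_energy \<sigma> q u"
proof -
  have "ennreal (\<bar>c * u x - c * u y\<bar> powr q / dist x y powr k) =
      ennreal (\<bar>c\<bar> powr q) * ennreal (\<bar>u x - u y\<bar> powr q / dist x y powr k)" for x y and k :: real
    by (simp add: powr_mult abs_mult right_diff_distrib[symmetric] flip: ennreal_mult')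
  then have "gagliardo_energy \<sigma> q (\<lambda>x. c * u x) = (\<integral>\<^sup>+ p. ennreal (\<bar>c\<bar> powr q) *
     (case p of (x, y) \<Rightarrow> ennreal (\<bar>u x - u y\<bar> powr q / dist x y powr (real DIM('a) + \<sigma> * q))) \<partial>(lebesgue \<Otimes>\<^sub>M lebesgue))"
    unfolding gagliardo_energy_def by (simp add: case_prod_unfold)
  also have "\<dots> = ennreal (\<bar>c\<bar> powr q) * gagliardo_energy \<sigma> q u"
    unfolding gagliardo_energy_def by (rule nn_integral_cmult) measurable
  finally show ?thesis .
qed

lemma gagliardo_energy_two_add_le:
  fixes u v :: "'a::euclidean_space \<Rightarrow> real"
  assumes [measurable]: "u \<in> borel_measurable lebesgue" "v \<in> borel_measurable lebesgue"
  shows "gagliardo_energy \<sigma> 2 (\<lambda>x. u x + v x) \<le> 2 * gagliardo_energy \<sigma> 2 u + 2 * gagliardo_energy \<sigma> 2 v"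
proof -
  have "ennreal (\<bar>u x + v x - (u y + v y)\<bar> powr 2 / dist x y powr k) \<le>
      2 * ennreal (\<bar>u x - u y\<bar> powr 2 / dist x y powr k) + 2 * ennreal (\<bar>v x - v y\<bar> powr 2 / dist x y powr k)"
    for x y and k :: real
  proof -
    define a b where "a = u x - u y" and "b = v x - v y"
    have "(a + b)\<^sup>2 \<le> 2 * a\<^sup>2 + 2 * b\<^sup>2"
      using zero_le_power2[of "a - b"] by (simp add: power2_eq_square algebra_simps)
    then have "(a + b)\<^sup>2 / dist x y powr k \<le> (2 * a\<^sup>2 + 2 * b\<^sup>2) / dist x y powr k"
      by (rule divide_right_mono) simp
    then have "ennreal ((a + b)\<^sup>2 / dist x y powr k) \<le> ennreal (2 * (a\<^sup>2 / dist x y powr k) + 2 * (b\<^sup>2 / dist x y powr k))"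
      by (intro ennreal_leI) (simp add: add_divide_distrib)
    also have "\<dots> = 2 * ennreal (a\<^sup>2 / dist x y powr k) + 2 * ennreal (b\<^sup>2 / dist x y powr k)"
      by (simp add: ennreal_plus ennreal_mult del: times_divide_eq_right)
    also have "a + b = u x + v x - (u y + v y)" by (simp add: a_def b_def)
    finally show ?thesis by (simp add: powr_abs_two a_def b_def)
  qed
  then have "gagliardo_energy \<sigma> 2 (\<lambda>x. u x + v x) \<le> (\<integral>\<^sup>+ p.
     2 * (case p of (x, y) \<Rightarrow> ennreal (\<bar>u x - u y\<bar> powr 2 / dist x y powr (real DIM('a) + \<sigma> * 2))) +
     2 * (case p of (x, y) \<Rightarrow> ennreal (\<bar>v x - v y\<bar> powr 2 / dist x y powr (real DIM('a) + \<sigma> * 2))) \<partial>(lebesgue \<Otimes>\<^sub>M lebesgue))"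
    unfolding gagliardo_energy_def by (intro nn_integral_mono) (auto simp: split_beta)
  also have "\<dots> = 2 * gagliardo_energy \<sigma> 2 u + 2 * gagliardo_energy \<sigma> 2 v"
    unfolding gagliardo_energy_def by (simp add: nn_integral_add nn_integral_cmult)
  finally show ?thesis .
qed

lemma integrable_powr_le:
  fixes u :: "'a \<Rightarrow> real"
  assumes [measurable]: "u \<in> borel_measurable M" "\<Omega> \<in> sets M"
    and "emeasure M \<Omega> < \<infinity>" and zero: "AE x in M. x \<notin> \<Omega> \<longrightarrow> u x = 0"
    and "integrable M (\<lambda>x. (u x)\<^sup>2)" and "0 < q" "q \<le> 2"
  shows "integrable M (\<lambda>x. \<bar>u x\<bar> powr q)"
proof (rule Bochner_Integration.integrable_bound)
  show "integrable M (\<lambda>x. (u x)\<^sup>2 + indicator \<Omega> x)"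
    using assms by (intro Bochner_Integration.integrable_add) (auto simp: integrable_indicator_iff)
  show "AE x in M. norm (\<bar>u x\<bar> powr q) \<le> norm ((u x)\<^sup>2 + indicator \<Omega> x :: real)"
    using zero
  proof eventually_elim
    case (elim x)
    have "\<bar>u x\<bar> powr q \<le> (u x)\<^sup>2 + 1"
    proof (cases "\<bar>u x\<bar> \<le> 1")
      case True
      then have "\<bar>u x\<bar> powr q \<le> 1" using \<open>0 < q\<close> by (intro powr_le1) auto
      then show ?thesis by (simp add: add_increasing)
    next
      case False
      then have "\<bar>u x\<bar> powr q \<le> \<bar>u x\<bar> powr 2" using \<open>q \<le> 2\<close> by (intro powr_mono) auto
      then show ?thesis by (simp add: powr_abs_two)
    qed
    then show ?case using elim by (cases "x \<in> \<Omega>") auto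
  qed
qed measurable

lemma emeasure_support_le:
  fixes u :: "'a::euclidean_space \<Rightarrow> real"
  assumes "\<Omega> \<in> sets lebesgue" "AE x in lebesgue. x \<notin> \<Omega> \<longrightarrow> u x = 0"
  shows "emeasure lebesgue {x. u x \<noteq> 0} \<le> emeasure lebesgue \<Omega>"
  by (rule emeasure_mono_AE) (use assms in auto)

section \<open>Homogeneity and the dual norm\<close>

lemma frac_sobolev0_scale:
  assumes "u \<in> frac_sobolev0 \<Omega> \<sigma> q" "0 < q"
  shows "(\<lambda>x. c * u x) \<in> frac_sobolev0 \<Omega> \<sigma> q"
    and "frac_sobolev0_norm \<sigma> q (\<lambda>x. c * u x) = \<bar>c\<bar> * frac_sobolev0_norm \<sigma> q u"
proof -
  have u: "u \<in> borel_measurable lebesgue" "gagliardo_energy \<sigma> q u < \<infinity>"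
    using assms by (auto simp: frac_sobolev0_def frac_sobolev_def)
  show "(\<lambda>x. c * u x) \<in> frac_sobolev0 \<Omega> \<sigma> q"
    using assms gagliardo_energy_scale[OF u(1) \<open>0 < q\<close>, of \<sigma> c]
    by (auto simp: frac_sobolev0_def frac_sobolev_def abs_mult powr_mult ennreal_mult_less_top)
  show "frac_sobolev0_norm \<sigma> q (\<lambda>x. c * u x) = \<bar>c\<bar> * frac_sobolev0_norm \<sigma> q u"
    using assms by (simp add: frac_sobolev0_norm_def gagliardo_energy_scale[OF u(1)] enn2real_mult powr_mult powr_powr)
qed

text \<open>The dual norm is a supremum of reals, which is meaningful only for a set bounded above;
  the constant \<open>B\<close> in the definition of the dual provides this. Homogeneity then
  extends the bound from the unit ball.\<close>

lemma frac_sobolev0_dual_bound: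
  fixes z :: "('a::euclidean_space \<Rightarrow> real) \<Rightarrow> real"
  assumes z: "z \<in> frac_sobolev0_dual \<Omega> \<sigma> q" and "0 < q"
  shows "0 \<le> frac_sobolev0_dual_norm \<Omega> \<sigma> q z"
    and "u \<in> frac_sobolev0 \<Omega> \<sigma> q \<Longrightarrow> \<bar>z u\<bar> \<le> frac_sobolev0_dual_norm \<Omega> \<sigma> q z * frac_sobolev0_norm \<sigma> q u"
proof -
  let ?S = "{u \<in> frac_sobolev0 \<Omega> \<sigma> q. frac_sobolev0_norm \<sigma> q u \<le> 1}"
  obtain B where B: "\<And>u. u \<in> frac_sobolev0 \<Omega> \<sigma> q \<Longrightarrow> \<bar>z u\<bar> \<le> B * frac_sobolev0_norm \<sigma> q u"
    using z unfolding frac_sobolev0_dual_def by blast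
  have nonneg: "0 \<le> frac_sobolev0_norm \<sigma> q u" for u :: "'a \<Rightarrow> real"
    by (simp add: frac_sobolev0_norm_def)
  have "\<bar>z u\<bar> \<le> \<bar>B\<bar>" if "u \<in> ?S" for u
  proof -
    have "\<bar>z u\<bar> \<le> B * frac_sobolev0_norm \<sigma> q u" using B that by simp
    also have "\<dots> \<le> \<bar>B\<bar> * frac_sobolev0_norm \<sigma> q u" using nonneg by (intro mult_right_mono) auto
    also have "\<dots> \<le> \<bar>B\<bar> * 1" using that by (intro mult_left_mono) auto
    finally show ?thesis by simp
  qed
  then have bdd: "bdd_above ((\<lambda>u. \<bar>z u\<bar>) ` ?S)" by (intro bdd_aboveI2)
  have upper: "\<bar>z u\<bar> \<le> frac_sobolev0_dual_norm \<Omega> \<sigma> q z" if "u \<in> ?S" for u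
    unfolding frac_sobolev0_dual_norm_def using bdd that by (intro cSUP_upper) auto
  have "(\<lambda>x. 0) \<in> ?S"
    using \<open>0 < q\<close> by (simp add: frac_sobolev0_def frac_sobolev_def gagliardo_energy_def frac_sobolev0_norm_def case_prod_unfold)
  from upper[OF this] show "0 \<le> frac_sobolev0_dual_norm \<Omega> \<sigma> q z" by linarith
  assume u: "u \<in> frac_sobolev0 \<Omega> \<sigma> q"
  let ?n = "frac_sobolev0_norm \<sigma> q u"
  show "\<bar>z u\<bar> \<le> frac_sobolev0_dual_norm \<Omega> \<sigma> q z * ?n"
  \<comment> \<open>A function of norm 0 cannot be normalized; for it the bound by \<open>B\<close>
    already gives \<open>z u = 0\<close>.\<close>
  proof (cases "?n = 0")
    case False
    then have n: "?n > 0" using nonneg[of u] by simp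
    have "(\<lambda>x. (1 / ?n) * u x) \<in> ?S"
      using frac_sobolev0_scale[OF u \<open>0 < q\<close>, of "1 / ?n"] n by simp
    moreover have "z (\<lambda>x. (1 / ?n) * u x) = (1 / ?n) * z u"
      using z u unfolding frac_sobolev0_dual_def by blast
    ultimately have "\<bar>(1 / ?n) * z u\<bar> \<le> frac_sobolev0_dual_norm \<Omega> \<sigma> q z"
      using upper by metis
    then show ?thesis using n by (simp add: abs_mult field_simps)
  qed (use B[OF u] in simp)
qed

lemma frac_laplacian_const_pos: "0 < s \<Longrightarrow> s < 1 \<Longrightarrow> 0 < frac_laplacian_const N s"
  unfolding frac_laplacian_const_def by (intro divide_pos_pos mult_pos_pos Gamma_real_pos) auto

text \<open>The Poincare inequality, obtained from \<open>faber_krahn\<close> with the one volume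
  bound \<open>M\<close> for all supports.\<close>

lemma nn_integral_square_le_energy:
  fixes \<Omega> :: "'a::euclidean_space set"
  assumes "\<Omega> \<in> sets lebesgue" "emeasure lebesgue \<Omega> \<le> ennreal M" "0 < M" "0 \<le> s"
  obtains C where "C > 0" "\<And>u :: 'a \<Rightarrow> real. u \<in> borel_measurable lebesgue \<Longrightarrow>
      (AE x in lebesgue. x \<notin> \<Omega> \<longrightarrow> u x = 0) \<Longrightarrow>
      (\<integral>\<^sup>+ x. ennreal ((u x)\<^sup>2) \<partial>lebesgue) \<le> ennreal C * gagliardo_energy s 2 u"
proof -
  let ?\<omega> = "unit_ball_vol (real DIM('a))"
  let ?C = "2 / ?\<omega> * (2 * M / ?\<omega>) powr (2 * s / real DIM('a))"
  have \<omega>: "?\<omega> > 0" by (rule unit_ball_vol_pos) simp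
  show ?thesis
  proof (rule that)
    show "?C > 0" using \<open>0 < M\<close> \<omega>[THEN less_imp_neq, symmetric] by (intro mult_pos_pos divide_pos_pos \<omega>) auto
    fix u :: "'a \<Rightarrow> real"
    assume u: "u \<in> borel_measurable lebesgue" "AE x in lebesgue. x \<notin> \<Omega> \<longrightarrow> u x = 0"
    have "emeasure lebesgue {x. u x \<noteq> 0} \<le> ennreal M"
      using emeasure_support_le[OF assms(1) u(2)] assms(2) by (rule order_trans)
    then show "(\<integral>\<^sup>+ x. ennreal ((u x)\<^sup>2) \<partial>lebesgue) \<le> ennreal ?C * gagliardo_energy s 2 u"
      by (rule faber_krahn[OF u(1) \<open>0 \<le> s\<close> \<open>0 < M\<close>])
  qed
qed

text \<open>By the Poincare inequality, square integrability comes for free once the energy is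
  finite and the function vanishes outside \<open>\<Omega>\<close>. All later membership proofs
  check only measurability, finite energy and vanishing.\<close>

lemma frac_sobolev0_two_iff:
  fixes \<Omega> :: "'a::euclidean_space set"
  assumes "\<Omega> \<in> sets lebesgue" "emeasure lebesgue \<Omega> \<le> ennreal M" "0 < M" "0 \<le> s"
  shows "u \<in> frac_sobolev0 \<Omega> s 2 \<longleftrightarrow> u \<in> borel_measurable lebesgue \<and> gagliardo_energy s 2 u < \<infinity> \<and>
    (AE x in lebesgue. x \<notin> \<Omega> \<longrightarrow> u x = 0)"
proof
  assume u: "u \<in> borel_measurable lebesgue \<and> gagliardo_energy s 2 u < \<infinity> \<and>
    (AE x in lebesgue. x \<notin> \<Omega> \<longrightarrow> u x = 0)"
  obtain C where "C > 0" "\<And>u :: 'a \<Rightarrow> real. u \<in> borel_measurable lebesgue \<Longrightarrow>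
      (AE x in lebesgue. x \<notin> \<Omega> \<longrightarrow> u x = 0) \<Longrightarrow>
      (\<integral>\<^sup>+ x. ennreal ((u x)\<^sup>2) \<partial>lebesgue) \<le> ennreal C * gagliardo_energy s 2 u"
    using nn_integral_square_le_energy[OF assms] by blast
  then have "(\<integral>\<^sup>+ x. ennreal ((u x)\<^sup>2) \<partial>lebesgue) \<le> ennreal C * gagliardo_energy s 2 u"
    using u by blast
  also have "\<dots> < \<infinity>" using u by (simp add: ennreal_mult_less_top)
  finally have "integrable lebesgue (\<lambda>x. (u x)\<^sup>2)"
    using u by (intro integrableI_nonneg) auto
  then show "u \<in> frac_sobolev0 \<Omega> s 2"
    using u by (simp add: frac_sobolev0_def frac_sobolev_def powr_abs_two)
qed (auto simp: frac_sobolev0_def frac_sobolev_def)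

lemma energy_zero_imp_AE_zero:
  fixes \<Omega> :: "'a::euclidean_space set"
  assumes "\<Omega> \<in> sets lebesgue" "emeasure lebesgue \<Omega> \<le> ennreal M" "0 < M" "0 \<le> s"
    and u: "u \<in> frac_sobolev0 \<Omega> s 2" and "gagliardo_energy s 2 u = 0"
  shows "AE x in lebesgue. u x = 0"
proof -
  note u' = u[unfolded frac_sobolev0_two_iff[OF assms(1-4)]]
  obtain C where "C > 0" "\<And>u :: 'a \<Rightarrow> real. u \<in> borel_measurable lebesgue \<Longrightarrow>
      (AE x in lebesgue. x \<notin> \<Omega> \<longrightarrow> u x = 0) \<Longrightarrow>
      (\<integral>\<^sup>+ x. ennreal ((u x)\<^sup>2) \<partial>lebesgue) \<le> ennreal C * gagliardo_energy s 2 u"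
    using nn_integral_square_le_energy[OF assms(1-4)] by blast
  then have "(\<integral>\<^sup>+ x. ennreal ((u x)\<^sup>2) \<partial>lebesgue) \<le> ennreal C * gagliardo_energy s 2 u"
    using u' by blast
  then have "(\<integral>\<^sup>+ x. ennreal ((u x)\<^sup>2) \<partial>lebesgue) = 0" using assms(6) by simp
  then have "AE x in lebesgue. ennreal ((u x)\<^sup>2) = 0"
    using u' by (subst (asm) nn_integral_0_iff_AE) auto
  then show ?thesis by eventually_elim (simp add: ennreal_eq_0_iff)
qed

lemma frac_sobolev0_two_add:
  fixes \<Omega> :: "'a::euclidean_space set"
  assumes "\<Omega> \<in> sets lebesgue" "emeasure lebesgue \<Omega> \<le> ennreal M" "0 < M" "0 \<le> s"
    and u: "u \<in> frac_sobolev0 \<Omega> s 2" and v: "v \<in> frac_sobolev0 \<Omega> s 2"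
  shows "(\<lambda>x. u x + v x) \<in> frac_sobolev0 \<Omega> s 2"
proof -
  note u' = u[unfolded frac_sobolev0_two_iff[OF assms(1-4)]] and v' = v[unfolded frac_sobolev0_two_iff[OF assms(1-4)]]
  have "gagliardo_energy s 2 (\<lambda>x. u x + v x) \<le> 2 * gagliardo_energy s 2 u + 2 * gagliardo_energy s 2 v"
    using u' v' by (intro gagliardo_energy_two_add_le) auto
  also have "\<dots> < \<infinity>" using u' v' by (simp add: ennreal_mult_less_top)
  finally have "gagliardo_energy s 2 (\<lambda>x. u x + v x) < \<infinity>" .
  moreover have "AE x in lebesgue. x \<notin> \<Omega> \<longrightarrow> u x + v x = 0"
    using u'[THEN conjunct2, THEN conjunct2] v'[THEN conjunct2, THEN conjunct2] by eventually_elim simp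
  ultimately show ?thesis using u' v'
    unfolding frac_sobolev0_two_iff[OF assms(1-4)] by (auto intro: borel_measurable_add)
qed

lemma frac_sobolev0_two_diff:
  fixes \<Omega> :: "'a::euclidean_space set"
  assumes "\<Omega> \<in> sets lebesgue" "emeasure lebesgue \<Omega> \<le> ennreal M" "0 < M" "0 \<le> s"
    and u: "u \<in> frac_sobolev0 \<Omega> s 2" and v: "v \<in> frac_sobolev0 \<Omega> s 2"
  shows "(\<lambda>x. u x - v x) \<in> frac_sobolev0 \<Omega> s 2"
  using frac_sobolev0_two_add[OF assms(1-4) u frac_sobolev0_scale(1)[OF v, of "-1"]] by simp

section \<open>The bilinear form as a Bochner integral and its relation to the energy\<close>

lemma has_bochner_integral_energy:
  fixes u :: "'a::euclidean_space \<Rightarrow> real"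
  assumes [measurable]: "u \<in> borel_measurable lebesgue" and "gagliardo_energy s 2 u < \<infinity>"
  shows "has_bochner_integral (lebesgue \<Otimes>\<^sub>M lebesgue)
    (\<lambda>(x, y). (u x - u y) * (u x - u y) / dist x y powr (real DIM('a) + 2 * s)) (enn2real (gagliardo_energy s 2 u))"
proof (rule has_bochner_integral_nn_integral)
  have "(\<lambda>(x, y). (u x - u y) * (u x - u y) / dist x y powr (real DIM('a) + 2 * s)) =
     (\<lambda>(x, y). \<bar>u x - u y\<bar> powr 2 / dist x y powr (real DIM('a) + s * 2))"
    by (simp add: powr_abs_two power2_eq_square mult.commute)
  then show "(\<integral>\<^sup>+ p. ennreal (case p of (x, y) \<Rightarrow> (u x - u y) * (u x - u y) / dist x y powr (real DIM('a) + 2 * s))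
      \<partial>(lebesgue \<Otimes>\<^sub>M lebesgue)) = ennreal (enn2real (gagliardo_energy s 2 u))"
    using assms(2) by (simp add: gagliardo_energy_def case_prod_unfold)
qed (auto simp: split_beta)

lemma integrable_form:
  fixes u v :: "'a::euclidean_space \<Rightarrow> real"
  assumes [measurable]: "u \<in> borel_measurable lebesgue" "v \<in> borel_measurable lebesgue"
    and "gagliardo_energy s 2 u < \<infinity>" "gagliardo_energy s 2 v < \<infinity>"
  shows "integrable (lebesgue \<Otimes>\<^sub>M lebesgue)
    (\<lambda>(x, y). (u x - u y) * (v x - v y) / dist x y powr (real DIM('a) + 2 * s))"
proof (rule Bochner_Integration.integrable_bound)
  let ?g = "\<lambda>u :: 'a \<Rightarrow> real. \<lambda>(x, y). (u x - u y) * (u x - u y) / dist x y powr (real DIM('a) + 2 * s)"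
  show "integrable (lebesgue \<Otimes>\<^sub>M lebesgue) (\<lambda>p. ?g u p + ?g v p)"
    using has_bochner_integral_energy[OF assms(1,3)] has_bochner_integral_energy[OF assms(2,4)]
    by (intro Bochner_Integration.integrable_add) (auto simp: has_bochner_integral_iff)
  have "\<bar>a * b\<bar> \<le> a * a + b * b" for a b :: real
  proof -
    have "0 \<le> (\<bar>a\<bar> - \<bar>b\<bar>)\<^sup>2" by simp
    also have "\<dots> = a * a + b * b - 2 * \<bar>a * b\<bar>"
      by (simp add: power2_eq_square algebra_simps abs_mult)
    finally show ?thesis by linarith
  qed
  from divide_right_mono[OF this]
  have "\<bar>a * b / d powr k\<bar> \<le> a * a / d powr k + b * b / d powr k" for a b d k :: real
    by (simp add: add_divide_distrib[symmetric] abs_mult)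
  then show "AE p in lebesgue \<Otimes>\<^sub>M lebesgue. norm (case p of (x, y) \<Rightarrow> (u x - u y) * (v x - v y) / dist x y powr (real DIM('a) + 2 * s))
      \<le> norm (?g u p + ?g v p)"
    by (intro AE_I2) (auto intro: order_trans[OF _ abs_ge_self])
qed (simp add: split_beta)

lemma frac_laplacian_form_self:
  fixes u :: "'a::euclidean_space \<Rightarrow> real"
  assumes "u \<in> borel_measurable lebesgue" "gagliardo_energy s 2 u < \<infinity>"
  shows "frac_laplacian_form s u u = frac_laplacian_const DIM('a) s / 2 * enn2real (gagliardo_energy s 2 u)"
  using has_bochner_integral_energy[OF assms] by (simp add: frac_laplacian_form_def has_bochner_integral_iff)

lemma frac_laplacian_form_sym: "frac_laplacian_form s u v = frac_laplacian_form s v u"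
  by (simp add: frac_laplacian_form_def mult.commute)

lemma frac_laplacian_form_scale: "frac_laplacian_form s (\<lambda>x. c * u x) v = c * frac_laplacian_form s u v"
proof -
  have "(\<lambda>(x, y). (c * u x - c * u y) * (v x - v y) / dist x y powr k) =
     (\<lambda>p. c * (case p of (x, y) \<Rightarrow> (u x - u y) * (v x - v y) / dist x y powr k))" for k
    by (auto simp: fun_eq_iff right_diff_distrib[symmetric])
  then show ?thesis by (simp add: frac_laplacian_form_def)
qed

lemma frac_laplacian_form_add:
  fixes u v w :: "'a::euclidean_space \<Rightarrow> real"
  assumes "u \<in> borel_measurable lebesgue" "v \<in> borel_measurable lebesgue" "w \<in> borel_measurable lebesgue"
    and "gagliardo_energy s 2 u < \<infinity>" "gagliardo_energy s 2 v < \<infinity>" "gagliardo_energy s 2 w < \<infinity>"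
  shows "frac_laplacian_form s (\<lambda>x. u x + v x) w = frac_laplacian_form s u w + frac_laplacian_form s v w"
proof -
  let ?g = "\<lambda>u :: 'a \<Rightarrow> real. \<lambda>(x, y). (u x - u y) * (w x - w y) / dist x y powr (real DIM('a) + 2 * s)"
  have "?g (\<lambda>x. u x + v x) = (\<lambda>p. ?g u p + ?g v p)"
    by (simp add: fun_eq_iff add_diff_add distrib_right add_divide_distrib)
  then have "(\<integral>p. ?g (\<lambda>x. u x + v x) p \<partial>(lebesgue \<Otimes>\<^sub>M lebesgue)) =
     (\<integral>p. ?g u p \<partial>(lebesgue \<Otimes>\<^sub>M lebesgue)) + (\<integral>p. ?g v p \<partial>(lebesgue \<Otimes>\<^sub>M lebesgue))"
    using assms by (simp add: Bochner_Integration.integral_add integrable_form)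
  then show ?thesis by (simp add: frac_laplacian_form_def distrib_left)
qed

text \<open>Besides the inclusion, this records the gain from a small support: the power
  \<open>1/q - 1/2\<close> of \<open>m\<close> is positive because \<open>q < 2\<close>, and it
  supplies part of the exponent in the truncation argument.\<close>

lemma frac_sobolev0_embedding:
  fixes \<Omega> :: "'a::euclidean_space set"
  assumes \<Omega>: "\<Omega> \<in> sets lebesgue" "emeasure lebesgue \<Omega> \<le> ennreal M" "0 < M"
    and "1 \<le> q" "q < 2" "0 < t" "t < s"
  obtains K where "K > 0" "frac_sobolev0 \<Omega> s 2 \<subseteq> frac_sobolev0 \<Omega> t q"
    "\<And>v m. v \<in> frac_sobolev0 \<Omega> s 2 \<Longrightarrow> 0 < m \<Longrightarrow> m \<le> M \<Longrightarrow> emeasure lebesgue {x. v x \<noteq> 0} \<le> ennreal m \<Longrightarrow>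
      frac_sobolev0_norm t q v \<le> K * sqrt (enn2real (gagliardo_energy s 2 v)) * m powr (1 / q - 1 / 2)"
proof -
  have s: "0 \<le> s" using assms by simp
  obtain C\<^sub>1 where C\<^sub>1: "C\<^sub>1 > 0" "\<And>(v :: 'a::euclidean_space \<Rightarrow> real) m \<eta>. v \<in> borel_measurable lebesgue \<Longrightarrow>
       emeasure lebesgue {x. v x \<noteq> 0} \<le> ennreal m \<Longrightarrow> 0 < \<eta> \<Longrightarrow> 0 < m \<Longrightarrow>
       gagliardo_energy t q v \<le> ennreal \<eta> * (gagliardo_energy s 2 v + ennreal C\<^sub>1 * (\<integral>\<^sup>+ x. ennreal ((v x)\<^sup>2) \<partial>lebesgue))
         + ennreal (C\<^sub>1 * \<eta> powr (- (q / (2 - q))) * m)"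
    using gagliardo_energy_embedding[OF assms(4-7), where 'a = 'a] by blast
  obtain C\<^sub>2 where C\<^sub>2: "C\<^sub>2 > 0" "\<And>u :: 'a \<Rightarrow> real. u \<in> borel_measurable lebesgue \<Longrightarrow>
      (AE x in lebesgue. x \<notin> \<Omega> \<longrightarrow> u x = 0) \<Longrightarrow>
      (\<integral>\<^sup>+ x. ennreal ((u x)\<^sup>2) \<partial>lebesgue) \<le> ennreal C\<^sub>2 * gagliardo_energy s 2 u"
    using nn_integral_square_le_energy[OF \<Omega> s] by blast
  \<comment> \<open>The three terms stem from the energy, from the \<open>L\<^sup>2\<close> term
    after the Poincare inequality, and from the support term.\<close>
  define A where "A = 1 + C\<^sub>1 * C\<^sub>2 + C\<^sub>1"
  have A: "A > 0" using C\<^sub>1 C\<^sub>2 by (simp add: A_def add_pos_pos)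
  note iff = frac_sobolev0_two_iff[OF \<Omega> s]
  have energy: "gagliardo_energy t q v \<le> ennreal (A * m powr (1 - q / 2) * e powr (q / 2))"
    if v: "v \<in> frac_sobolev0 \<Omega> s 2" and m: "0 < m" "emeasure lebesgue {x. v x \<noteq> 0} \<le> ennreal m"
      and e: "0 < e" "gagliardo_energy s 2 v \<le> ennreal e" for v m e
  proof -
    note v' = v[unfolded iff]
    \<comment> \<open>The value of \<open>\<eta>\<close> that balances the two terms: both
      \<open>\<eta> * e\<close> and \<open>\<eta> powr (- (q / (2 - q))) * m\<close> become
      \<open>P\<close>.\<close>
    define \<eta> P where "\<eta> = m powr (1 - q / 2) * e powr (q / 2 - 1)" and "P = m powr (1 - q / 2) * e powr (q / 2)"
    have \<eta>: "\<eta> > 0" using m e by (simp add: \<eta>_def)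
    have \<eta>e: "\<eta> * e = P"
    proof -
      have "e powr (q / 2 - 1) * e = e powr (q / 2)" using e by (simp add: powr_diff)
      then show ?thesis by (simp add: \<eta>_def P_def mult.assoc)
    qed
    have \<eta>m: "\<eta> powr (- (q / (2 - q))) * m = P"
    proof -
      have "(1 - q / 2) * - (q / (2 - q)) = - (q / 2)" "(q / 2 - 1) * - (q / (2 - q)) = q / 2"
        using \<open>q < 2\<close> by (simp_all add: divide_simps) (simp_all add: algebra_simps)
      then have "\<eta> powr (- (q / (2 - q))) = m powr (- (q / 2)) * e powr (q / 2)"
        using m e unfolding \<eta>_def by (simp only: powr_mult powr_powr)
      moreover have "m powr (- (q / 2)) * m = m powr (1 - q / 2)"
        using m powr_add[of m "- (q / 2)" 1] by simp
      ultimately show ?thesis by (simp add: P_def mult_ac)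
    qed
    have "gagliardo_energy t q v \<le> ennreal \<eta> * (gagliardo_energy s 2 v + ennreal C\<^sub>1 * (\<integral>\<^sup>+ x. ennreal ((v x)\<^sup>2) \<partial>lebesgue))
         + ennreal (C\<^sub>1 * \<eta> powr (- (q / (2 - q))) * m)"
      using v' m \<eta> by (intro C\<^sub>1) auto
    also have "\<dots> \<le> ennreal \<eta> * (ennreal e + ennreal C\<^sub>1 * (ennreal C\<^sub>2 * ennreal e))
         + ennreal (C\<^sub>1 * \<eta> powr (- (q / (2 - q))) * m)"
    proof -
      have "(\<integral>\<^sup>+ x. ennreal ((v x)\<^sup>2) \<partial>lebesgue) \<le> ennreal C\<^sub>2 * gagliardo_energy s 2 v"
        using v' by (intro C\<^sub>2) auto
      also have "\<dots> \<le> ennreal C\<^sub>2 * ennreal e" using e by (intro mult_left_mono) auto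
      finally show ?thesis using e by (intro add_right_mono mult_left_mono add_mono) auto
    qed
    also have "C\<^sub>1 * \<eta> powr (- (q / (2 - q))) * m = C\<^sub>1 * P" using \<eta>m by (simp only: mult.assoc)
    also have "ennreal \<eta> * (ennreal e + ennreal C\<^sub>1 * (ennreal C\<^sub>2 * ennreal e)) = ennreal (\<eta> * (e + C\<^sub>1 * (C\<^sub>2 * e)))"
      using C\<^sub>1(1) C\<^sub>2(1) e(1) \<eta> by (simp add: ennreal_mult ennreal_plus)
    also have "\<eta> * (e + C\<^sub>1 * (C\<^sub>2 * e)) = (1 + C\<^sub>1 * C\<^sub>2) * P"
      unfolding \<eta>e[symmetric] by (simp add: algebra_simps)
    also have "ennreal ((1 + C\<^sub>1 * C\<^sub>2) * P) + ennreal (C\<^sub>1 * P) = ennreal (A * P)"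
    proof -
      have "P \<ge> 0" by (simp add: P_def)
      then have "ennreal ((1 + C\<^sub>1 * C\<^sub>2) * P) + ennreal (C\<^sub>1 * P) = ennreal ((1 + C\<^sub>1 * C\<^sub>2) * P + C\<^sub>1 * P)"
        using C\<^sub>1(1) C\<^sub>2(1) by (intro ennreal_plus[symmetric]) auto
      then show ?thesis by (simp add: A_def algebra_simps)
    qed
    finally show ?thesis by (simp add: P_def mult.assoc)
  qed
  define K where "K = A powr (1 / q)"
  have K: "K > 0" using A by (simp add: K_def)
  have norm: "frac_sobolev0_norm t q v \<le> K * sqrt e * m powr (1 / q - 1 / 2)"
    if "v \<in> frac_sobolev0 \<Omega> s 2" "0 < m" "emeasure lebesgue {x. v x \<noteq> 0} \<le> ennreal m"
      "0 < e" "gagliardo_energy s 2 v \<le> ennreal e" for v m e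
  proof -
    have "frac_sobolev0_norm t q v \<le> (A * m powr (1 - q / 2) * e powr (q / 2)) powr (1 / q)"
      unfolding frac_sobolev0_norm_def
    proof (rule powr_mono2)
      show "enn2real (gagliardo_energy t q v) \<le> A * m powr (1 - q / 2) * e powr (q / 2)"
        using energy[OF that] A by (intro enn2real_leI) auto
    qed (use assms in auto)
    also have "\<dots> = K * sqrt e * m powr (1 / q - 1 / 2)"
    proof -
      have "(1 - q / 2) * (1 / q) = 1 / q - 1 / 2" "q / 2 * (1 / q) = 1 / 2"
        using \<open>1 \<le> q\<close> by (simp_all add: field_simps)
      then show ?thesis using A that
        by (simp only: powr_mult powr_powr K_def powr_half_sqrt) (simp add: mult_ac powr_mult powr_half_sqrt)
    qed
    finally show ?thesis .
  qed
  show ?thesis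
  proof (rule that[OF K])
    show "frac_sobolev0 \<Omega> s 2 \<subseteq> frac_sobolev0 \<Omega> t q"
    proof
      fix v assume v: "v \<in> frac_sobolev0 \<Omega> s 2"
      note v' = v[unfolded iff]
      \<comment> \<open>For the inclusion any positive bound on the energy will do.\<close>
      let ?e = "enn2real (gagliardo_energy s 2 v) + 1"
      have "emeasure lebesgue {x. v x \<noteq> 0} \<le> ennreal M"
        using emeasure_support_le[OF \<Omega>(1)] v' \<Omega>(2) by (meson order_trans)
      moreover have "0 < ?e" by (simp add: add_nonneg_pos)
      moreover have "gagliardo_energy s 2 v \<le> ennreal ?e"
        using v' by (cases "gagliardo_energy s 2 v") (auto simp flip: ennreal_plus intro: ennreal_leI)
      ultimately have "gagliardo_energy t q v \<le> ennreal (A * M powr (1 - q / 2) * ?e powr (q / 2))"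
        by (rule energy[OF v \<open>0 < M\<close>])
      then have "gagliardo_energy t q v < \<infinity>" by (rule le_less_trans) simp
      moreover have "integrable lebesgue (\<lambda>x. \<bar>v x\<bar> powr q)"
      proof (rule integrable_powr_le[of _ _ \<Omega>])
        show "emeasure lebesgue \<Omega> < \<infinity>" using \<Omega>(2) by (auto intro: le_less_trans)
        show "integrable lebesgue (\<lambda>x. (v x)\<^sup>2)"
          using v by (simp add: frac_sobolev0_def frac_sobolev_def powr_abs_two)
      qed (use v' \<Omega> assms in auto)
      ultimately show "v \<in> frac_sobolev0 \<Omega> t q"
        using v' by (simp add: frac_sobolev0_def frac_sobolev_def)
    qed
    fix v m assume v: "v \<in> frac_sobolev0 \<Omega> s 2" and m: "0 < m" "m \<le> M" "emeasure lebesgue {x. v x \<noteq> 0} \<le> ennreal m"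
    note v' = v[unfolded iff]
    let ?e = "enn2real (gagliardo_energy s 2 v)"
    \<comment> \<open>The balancing choice of \<open>\<eta>\<close> needs a positive energy bound,
      and the energy may be 0. Hence the bound is shifted by \<open>1 / (n + 1)\<close> and the
      limit is taken.\<close>
    have est: "frac_sobolev0_norm t q v \<le> K * sqrt (?e + inverse (real (Suc n))) * m powr (1 / q - 1 / 2)" for n
    proof (rule norm[OF v m(1,3)])
      show "0 < ?e + inverse (real (Suc n))" by (intro add_nonneg_pos) auto
      have "0 \<le> inverse (real (Suc n))" by simp
      then show "gagliardo_energy s 2 v \<le> ennreal (?e + inverse (real (Suc n)))"
        using v' by (cases "gagliardo_energy s 2 v") (auto intro!: ennreal_leI simp del: of_nat_Suc)
    qed
    have "(\<lambda>n. K * sqrt (?e + inverse (real (Suc n))) * m powr (1 / q - 1 / 2)) \<longlonglongrightarrow>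
        K * sqrt (?e + 0) * m powr (1 / q - 1 / 2)"
      by (intro tendsto_intros LIMSEQ_inverse_real_of_nat)
    then have "frac_sobolev0_norm t q v \<le> K * sqrt (?e + 0) * m powr (1 / q - 1 / 2)"
      by (rule tendsto_lowerbound) (use est in auto)
    then show "frac_sobolev0_norm t q v \<le> K * sqrt ?e * m powr (1 / q - 1 / 2)" by simp
  qed
qed

section \<open>Completeness, existence and uniqueness\<close>

lemma AE_lebesgue_pairI:
  assumes "AE x in (lebesgue :: 'a::euclidean_space measure). P x"
  shows "AE p in lebesgue \<Otimes>\<^sub>M lebesgue. P (fst p) \<and> P (snd p)"
proof -
  obtain N where N: "N \<in> null_sets (lebesgue :: 'a measure)" "{x \<in> space lebesgue. \<not> P x} \<subseteq> N"
    using assms unfolding eventually_ae_filter by blast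
  have [measurable]: "N \<in> sets lebesgue" using N(1) by auto
  have "AE p in lebesgue \<Otimes>\<^sub>M lebesgue. fst p \<notin> N \<and> snd p \<notin> N"
  proof (rule lebesgue_pair.AE_pair_measure)
    have "AE x in lebesgue. x \<notin> N" by (rule AE_not_in[OF N(1)])
    then show "AE x in lebesgue. AE y in lebesgue. fst (x, y) \<notin> N \<and> snd (x, y) \<notin> N"
      by eventually_elim (use AE_not_in[OF N(1)] in simp)
  qed measurable
  then show ?thesis
    by eventually_elim (use N(2) in auto)
qed

lemma convergent_of_summable_increments:
  fixes f :: "nat \<Rightarrow> real"
  assumes "summable (\<lambda>k. \<bar>f (Suc k) - f k\<bar>)"
  shows "convergent f"
proof -
  have "summable (\<lambda>k. f (Suc k) - f k)" using assms by (rule summable_rabs_cancel)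
  then have "(\<lambda>n. \<Sum>k<n. f (Suc k) - f k) \<longlonglongrightarrow> (\<Sum>k. f (Suc k) - f k)" by (rule summable_LIMSEQ)
  then have "(\<lambda>n. (f n - f 0) + f 0) \<longlonglongrightarrow> (\<Sum>k. f (Suc k) - f k) + f 0"
    unfolding sum_lessThan_telescope by (intro tendsto_add tendsto_const)
  then show ?thesis by (auto intro: convergentI)
qed

text \<open>Almost everywhere convergence passes to both coordinates of almost every pair, so the
  integrands converge and Fatou's lemma applies on the product.\<close>

lemma gagliardo_energy_two_fatou:
  fixes u :: "'a::euclidean_space \<Rightarrow> real"
  assumes [measurable]: "\<And>k. w k \<in> borel_measurable lebesgue"
    and conv: "AE x in lebesgue. (\<lambda>k. w k x) \<longlonglongrightarrow> u x"
    and bound: "\<And>k. k \<ge> n \<Longrightarrow> gagliardo_energy s 2 (w k) \<le> C"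
  shows "gagliardo_energy s 2 u \<le> C"
proof -
  \<comment> \<open>Multiplying by \<open>inverse\<close> rather than dividing makes the kernel a
    constant factor in the limit, so the diagonal needs no separate treatment.\<close>
  define g where "g v p = ennreal ((v (fst p) - v (snd p))\<^sup>2 * inverse (dist (fst p) (snd p) powr (real DIM('a) + s * 2)))"
    for v :: "'a \<Rightarrow> real" and p
  have E: "gagliardo_energy s 2 v = (\<integral>\<^sup>+ p. g v p \<partial>(lebesgue \<Otimes>\<^sub>M lebesgue))" for v :: "'a \<Rightarrow> real"
    by (simp add: gagliardo_energy_def g_def powr_abs_two divide_inverse case_prod_unfold)
  have "AE p in lebesgue \<Otimes>\<^sub>M lebesgue. (\<lambda>k. w k (fst p)) \<longlonglongrightarrow> u (fst p) \<and> (\<lambda>k. w k (snd p)) \<longlonglongrightarrow> u (snd p)"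
    by (rule AE_lebesgue_pairI[OF conv])
  then have "AE p in lebesgue \<Otimes>\<^sub>M lebesgue. g u p = liminf (\<lambda>k. g (w k) p)"
  proof eventually_elim
    case (elim p)
    then have "(\<lambda>k. g (w k) p) \<longlonglongrightarrow> g u p"
      unfolding g_def by (intro tendsto_ennrealI tendsto_intros) auto
    then show ?case by (intro lim_imp_Liminf[symmetric]) auto
  qed
  then have "gagliardo_energy s 2 u = (\<integral>\<^sup>+ p. liminf (\<lambda>k. g (w k) p) \<partial>(lebesgue \<Otimes>\<^sub>M lebesgue))"
    unfolding E by (rule nn_integral_cong_AE)
  also have "\<dots> \<le> liminf (\<lambda>k. \<integral>\<^sup>+ p. g (w k) p \<partial>(lebesgue \<Otimes>\<^sub>M lebesgue))"
    by (rule nn_integral_liminf) (simp add: g_def)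
  also have "\<dots> \<le> C"
    using bound unfolding E[symmetric] by (intro Liminf_le) (auto simp: eventually_sequentially)
  finally show ?thesis .
qed

text \<open>A Riesz-Fischer argument. The Poincare inequality turns the geometric decay of the
  energies into summable \<open>L\<^sup>1\<close> norms of the increments, so the sequence converges
  almost everywhere. Fatou's lemma, applied to \<open>w k - w n\<close> as \<open>k\<close> grows,
  gives the same rate for the limit.\<close>

lemma frac_sobolev0_two_complete:
  fixes \<Omega> :: "'a::euclidean_space set"
  assumes \<Omega>: "\<Omega> \<in> sets lebesgue" "emeasure lebesgue \<Omega> \<le> ennreal M" "0 < M" "0 \<le> s"
    and "0 \<le> B" and w: "\<And>n::nat. w n \<in> frac_sobolev0 \<Omega> s 2"
    and cauchy: "\<And>n k. n \<le> k \<Longrightarrow> gagliardo_energy s 2 (\<lambda>x. w k x - w n x) \<le> ennreal (B * (1/4) ^ n)"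
  obtains u where "u \<in> frac_sobolev0 \<Omega> s 2"
    "\<And>n. gagliardo_energy s 2 (\<lambda>x. u x - w n x) \<le> ennreal (B * (1/4) ^ n)"
proof -
  note iff = frac_sobolev0_two_iff[OF \<Omega>]
  have [measurable]: "\<Omega> \<in> sets lebesgue" "w n \<in> borel_measurable lebesgue" for n
    using \<Omega> w[of n] unfolding iff by auto
  obtain C where C: "C > 0" "\<And>u :: 'a \<Rightarrow> real. u \<in> borel_measurable lebesgue \<Longrightarrow>
      (AE x in lebesgue. x \<notin> \<Omega> \<longrightarrow> u x = 0) \<Longrightarrow>
      (\<integral>\<^sup>+ x. ennreal ((u x)\<^sup>2) \<partial>lebesgue) \<le> ennreal C * gagliardo_energy s 2 u"
    using nn_integral_square_le_energy[OF \<Omega>] by blast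
  define d where "d k x = \<bar>w (Suc k) x - w k x\<bar>" for k x
  have [measurable]: "d k \<in> borel_measurable lebesgue" for k unfolding d_def by measurable
  have AE0: "AE x in lebesgue. \<forall>n. x \<notin> \<Omega> \<longrightarrow> w n x = 0"
    using w unfolding iff by (subst AE_all_countable) auto
  have int_d: "(\<integral>\<^sup>+ x. ennreal (d k x) \<partial>lebesgue) \<le> ennreal ((M + C * B) * (1/2) ^ k)" for k
  proof -
    have "(\<integral>\<^sup>+ x. ennreal ((d k x)\<^sup>2) \<partial>lebesgue) = (\<integral>\<^sup>+ x. ennreal ((w (Suc k) x - w k x)\<^sup>2) \<partial>lebesgue)"
      by (simp add: d_def)
    also have "\<dots> \<le> ennreal C * gagliardo_energy s 2 (\<lambda>x. w (Suc k) x - w k x)"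
    proof (rule C(2))
      show "AE x in lebesgue. x \<notin> \<Omega> \<longrightarrow> w (Suc k) x - w k x = 0"
        using AE0 by eventually_elim simp
    qed measurable
    also have "\<dots> \<le> ennreal C * ennreal (B * (1/4) ^ k)"
      by (intro mult_left_mono cauchy) auto
    finally have d2: "(\<integral>\<^sup>+ x. ennreal ((d k x)\<^sup>2) \<partial>lebesgue) \<le> ennreal C * ennreal (B * (1/4) ^ k)" .
    have "AE x in lebesgue. ennreal (d k x) \<le> ennreal ((1/2) ^ k) * indicator \<Omega> x + ennreal (2 ^ k) * ennreal ((d k x)\<^sup>2)"
      using AE0
    proof eventually_elim
      case (elim x)
      show ?case
      proof (cases "x \<in> \<Omega>")
        case True
        \<comment> \<open>This passes from squares to first powers: if \<open>d k x\<close> exceeds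
          \<open>(1/2) ^ k\<close>, then \<open>2 ^ k * d k x\<close> is at least 1. On a set of
          finite measure the first term integrates to order \<open>(1/2) ^ k\<close>, and so does
          the second, as the squares decay like \<open>(1/4) ^ k\<close>.\<close>
        have "d k x \<le> (1/2) ^ k + 2 ^ k * (d k x)\<^sup>2"
        proof (cases "d k x \<le> (1/2) ^ k")
          case False
          then have "1 \<le> 2 ^ k * d k x" by (simp add: power_one_over field_simps)
          then have "1 * d k x \<le> (2 ^ k * d k x) * d k x" by (rule mult_right_mono) (simp add: d_def)
          then show ?thesis by (simp add: power2_eq_square mult.assoc add_increasing)
        qed (simp add: add_increasing2)
        then have "ennreal (d k x) \<le> ennreal ((1/2) ^ k + 2 ^ k * (d k x)\<^sup>2)" by (rule ennreal_leI)
        also have "\<dots> = ennreal ((1/2) ^ k) + ennreal (2 ^ k) * ennreal ((d k x)\<^sup>2)"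
          by (subst ennreal_plus) (auto intro: ennreal_mult)
        finally show ?thesis using True by simp
      qed (use elim in \<open>simp add: d_def\<close>)
    qed
    then have "(\<integral>\<^sup>+ x. ennreal (d k x) \<partial>lebesgue) \<le>
       (\<integral>\<^sup>+ x. ennreal ((1/2) ^ k) * indicator \<Omega> x + ennreal (2 ^ k) * ennreal ((d k x)\<^sup>2) \<partial>lebesgue)"
      by (rule nn_integral_mono_AE)
    also have "\<dots> = ennreal ((1/2) ^ k) * emeasure lebesgue \<Omega> + ennreal (2 ^ k) * (\<integral>\<^sup>+ x. ennreal ((d k x)\<^sup>2) \<partial>lebesgue)"
      by (subst nn_integral_add) (simp_all add: nn_integral_cmult nn_integral_cmult_indicator)
    also have "\<dots> \<le> ennreal ((1/2) ^ k) * ennreal M + ennreal (2 ^ k) * (ennreal C * ennreal (B * (1/4) ^ k))"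
      by (intro add_mono mult_left_mono d2 \<Omega>(2)) auto
    also have "\<dots> = ennreal ((1/2) ^ k * M + 2 ^ k * (C * (B * (1/4) ^ k)))"
      using C(1) \<open>0 \<le> B\<close> \<open>0 < M\<close> by (subst ennreal_plus) (auto simp: ennreal_mult simp del: power_one_over)
    also have "(1/2) ^ k * M + 2 ^ k * (C * (B * (1/4) ^ k)) = (M + C * B) * (1/2::real) ^ k"
    proof -
      have "(2::real) ^ k * (1/4) ^ k = (1/2) ^ k" by (simp flip: power_mult_distrib)
      then have "2 ^ k * (C * (B * (1/4) ^ k)) = C * B * (1/2::real) ^ k" by (simp add: mult_ac del: power_one_over)
      then show ?thesis by (simp add: algebra_simps)
    qed
    finally show ?thesis .
  qed
  have "(\<integral>\<^sup>+ x. (\<Sum>k. ennreal (d k x)) \<partial>lebesgue) = (\<Sum>k. \<integral>\<^sup>+ x. ennreal (d k x) \<partial>lebesgue)"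
    by (rule nn_integral_suminf) measurable
  also have "\<dots> \<le> (\<Sum>k. ennreal ((M + C * B) * (1/2) ^ k))"
    by (intro suminf_le int_d) auto
  also have "\<dots> = ennreal (\<Sum>k. (M + C * B) * (1/2) ^ k)"
    using C(1) \<open>0 \<le> B\<close> \<open>0 < M\<close> by (intro suminf_ennreal2 summable_mult summable_geometric) auto
  also have "\<dots> < \<infinity>" by simp
  finally have "AE x in lebesgue. (\<Sum>k. ennreal (d k x)) \<noteq> \<infinity>"
    by (intro nn_integral_PInf_AE) auto
  then have "AE x in lebesgue. convergent (\<lambda>n. w n x)"
  proof eventually_elim
    case (elim x)
    then have "summable (\<lambda>k. d k x)"
      by (intro summable_suminf_not_top) (auto simp: d_def)
    then show ?case unfolding d_def by (rule convergent_of_summable_increments)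
  qed
  then have conv: "AE x in lebesgue. (\<lambda>n. w n x) \<longlonglongrightarrow> lim (\<lambda>n. w n x)"
    by eventually_elim (simp add: convergent_LIMSEQ_iff)
  \<comment> \<open>Where the sequence diverges, \<open>lim\<close> has an unspecified value; this
    concerns only a null set.\<close>
  define u where "u x = lim (\<lambda>n. w n x)" for x
  have [measurable]: "u \<in> borel_measurable lebesgue" unfolding u_def by measurable
  have E: "gagliardo_energy s 2 (\<lambda>x. u x - w n x) \<le> ennreal (B * (1/4) ^ n)" for n
  proof (rule gagliardo_energy_two_fatou)
    show "(\<lambda>x. w k x - w n x) \<in> borel_measurable lebesgue" for k by measurable
    show "AE x in lebesgue. (\<lambda>k. w k x - w n x) \<longlonglongrightarrow> u x - w n x"
      using conv unfolding u_def by eventually_elim (intro tendsto_intros)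
  qed (rule cauchy)
  have "(\<lambda>x. u x - w 0 x) \<in> frac_sobolev0 \<Omega> s 2"
    unfolding iff
  proof (intro conjI)
    show "gagliardo_energy s 2 (\<lambda>x. u x - w 0 x) < \<infinity>"
      using E[of 0] by (rule le_less_trans) simp
    show "AE x in lebesgue. x \<notin> \<Omega> \<longrightarrow> u x - w 0 x = 0"
      using AE0 by eventually_elim (simp add: u_def)
  qed measurable
  from frac_sobolev0_two_add[OF \<Omega> this w[of 0]] have "u \<in> frac_sobolev0 \<Omega> s 2" by simp
  then show ?thesis using E by (rule that)
qed

section \<open>Solvability of the Dirichlet problem in the energy space\<close>

lemma enn2real_le_iff_le_ennreal:
  "x < \<infinity> \<Longrightarrow> 0 \<le> c \<Longrightarrow> enn2real x \<le> c \<longleftrightarrow> x \<le> ennreal c"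
  by (cases x) auto

text \<open>The functional is assumed bounded only with respect to the energy of order
  \<open>s\<close>; for functionals of order \<open>t\<close> this bound comes from the embedding.
  The form equals \<open>c\<close> times the energy on the diagonal, which turns \<open>B\<close>
  into \<open>B / sqrt c\<close> and the rate 4 into \<open>4 / c\<close>.\<close>

lemma dirichlet_solution_exists:
  fixes \<Omega> :: "'a::euclidean_space set" and z :: "('a \<Rightarrow> real) \<Rightarrow> real"
  assumes \<Omega>: "\<Omega> \<in> sets lebesgue" "emeasure lebesgue \<Omega> \<le> ennreal M" "0 < M" and s: "0 < s" "s < 1"
    and z_add: "\<And>u v. u \<in> frac_sobolev0 \<Omega> s 2 \<Longrightarrow> v \<in> frac_sobolev0 \<Omega> s 2 \<Longrightarrow> z (\<lambda>x. u x + v x) = z u + z v"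
    and z_scale: "\<And>c u. u \<in> frac_sobolev0 \<Omega> s 2 \<Longrightarrow> z (\<lambda>x. c * u x) = c * z u"
    and z_bound: "\<And>u. u \<in> frac_sobolev0 \<Omega> s 2 \<Longrightarrow> \<bar>z u\<bar> \<le> B * sqrt (enn2real (gagliardo_energy s 2 u))"
  shows "\<exists>u. dirichlet_solution \<Omega> s z u"
proof -
  let ?H = "frac_sobolev0 \<Omega> s 2" and ?b = "frac_laplacian_form s :: ('a \<Rightarrow> real) \<Rightarrow> _"
  have s0: "0 \<le> s" using s by simp
  note iff = frac_sobolev0_two_iff[OF \<Omega> s0]
  define c where "c = frac_laplacian_const DIM('a) s / 2"
  have c: "c > 0" using frac_laplacian_const_pos[OF s] by (simp add: c_def)
  have self: "?b u u = c * enn2real (gagliardo_energy s 2 u)" if "u \<in> ?H" for u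
    using that unfolding iff c_def by (intro frac_laplacian_form_self) auto
  have zero: "(\<lambda>x. 0) \<in> ?H"
    unfolding iff by (simp add: gagliardo_energy_def case_prod_unfold)
  obtain u where "u \<in> ?H" "\<And>v. v \<in> ?H \<Longrightarrow> ?b u v = z v"
  proof (rule riesz_representation_functions[of ?H ?b z "B / sqrt c"])
    show "(\<lambda>x. u x + v x) \<in> ?H" if "u \<in> ?H" "v \<in> ?H" for u v
      using frac_sobolev0_two_add[OF \<Omega> s0 that] .
    show "(\<lambda>x. k * u x) \<in> ?H" if "u \<in> ?H" for k u
      using frac_sobolev0_scale(1)[OF that] by simp
    show "?b (\<lambda>x. u x + v x) w = ?b u w + ?b v w" if "u \<in> ?H" "v \<in> ?H" "w \<in> ?H" for u v w
      using that unfolding iff by (intro frac_laplacian_form_add) auto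
    show "?b (\<lambda>x. k * u x) v = k * ?b u v" for k u v by (rule frac_laplacian_form_scale)
    show "?b u v = ?b v u" for u v by (rule frac_laplacian_form_sym)
    show "0 \<le> ?b u u" if "u \<in> ?H" for u using self[OF that] c by simp
    show "\<bar>z u\<bar> \<le> B / sqrt c * sqrt (?b u u)" if "u \<in> ?H" for u
      using z_bound[OF that] self[OF that] c by (simp add: real_sqrt_mult)
    show "\<exists>u\<in>?H. \<forall>n. ?b (\<lambda>x. u x - w n x) (\<lambda>x. u x - w n x) \<le> 4 * (1/4) ^ n"
      if w: "\<And>n. w n \<in> ?H"
        and cauchy: "\<And>n k. n \<le> k \<Longrightarrow> ?b (\<lambda>x. w k x - w n x) (\<lambda>x. w k x - w n x) \<le> 4 * (1/4) ^ n"
      for w :: "nat \<Rightarrow> 'a \<Rightarrow> real"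
    proof -
      have energy_iff: "?b v v \<le> 4 * (1/4) ^ n \<longleftrightarrow> gagliardo_energy s 2 v \<le> ennreal (4 / c * (1/4) ^ n)"
        if "v \<in> ?H" for v and n :: nat
      proof -
        have "?b v v \<le> 4 * (1/4) ^ n \<longleftrightarrow> enn2real (gagliardo_energy s 2 v) \<le> 4 / c * (1/4) ^ n"
          using self[OF that] c by (simp add: field_simps del: power_one_over)
        also have "\<dots> \<longleftrightarrow> gagliardo_energy s 2 v \<le> ennreal (4 / c * (1/4) ^ n)"
          using that c unfolding iff by (intro enn2real_le_iff_le_ennreal) auto
        finally show ?thesis .
      qed
      obtain u where u: "u \<in> ?H" "\<And>n. gagliardo_energy s 2 (\<lambda>x. u x - w n x) \<le> ennreal (4 / c * (1/4) ^ n)"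
      proof (rule frac_sobolev0_two_complete[OF \<Omega> s0 _ w])
        show "gagliardo_energy s 2 (\<lambda>x. w k x - w n x) \<le> ennreal (4 / c * (1/4) ^ n)" if "n \<le> k" for n k
          using cauchy[OF that] energy_iff[OF frac_sobolev0_two_diff[OF \<Omega> s0 w w]] by blast
      qed (use c in auto)
      then show ?thesis
        using energy_iff[OF frac_sobolev0_two_diff[OF \<Omega> s0 u(1) w]] by blast
    qed
  qed (use zero z_add z_scale in auto)
  then show ?thesis unfolding dirichlet_solution_def by blast
qed

text \<open>Testing both equations with the difference makes its energy vanish, and the Poincare
  inequality then makes the difference vanish almost everywhere.\<close>

lemma dirichlet_solution_unique:
  fixes \<Omega> :: "'a::euclidean_space set"
  assumes \<Omega>: "\<Omega> \<in> sets lebesgue" "emeasure lebesgue \<Omega> \<le> ennreal M" "0 < M" and s: "0 < s" "s < 1"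
    and u: "dirichlet_solution \<Omega> s z u" and w: "dirichlet_solution \<Omega> s z w"
  shows "AE x in lebesgue. w x = u x"
proof -
  have s0: "0 \<le> s" using s by simp
  note iff = frac_sobolev0_two_iff[OF \<Omega> s0]
  let ?d = "\<lambda>x. w x - u x"
  have H: "u \<in> frac_sobolev0 \<Omega> s 2" "w \<in> frac_sobolev0 \<Omega> s 2"
    using u w by (auto simp: dirichlet_solution_def)
  have d: "?d \<in> frac_sobolev0 \<Omega> s 2" by (rule frac_sobolev0_two_diff[OF \<Omega> s0 H(2,1)])
  have m: "(\<lambda>x. (-1) * u x) \<in> frac_sobolev0 \<Omega> s 2" by (rule frac_sobolev0_scale(1)[OF H(1)]) simp
  have "frac_laplacian_form s (\<lambda>x. w x + (-1) * u x) ?d = frac_laplacian_form s w ?d + frac_laplacian_form s (\<lambda>x. (-1) * u x) ?d"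
    using H(2) m d unfolding iff by (intro frac_laplacian_form_add) auto
  also have "\<dots> = frac_laplacian_form s w ?d + (-1) * frac_laplacian_form s u ?d"
    by (simp only: frac_laplacian_form_scale)
  also have "\<dots> = 0" using u w d by (simp add: dirichlet_solution_def)
  finally have "frac_laplacian_form s ?d ?d = 0" by simp
  then have "gagliardo_energy s 2 ?d = 0"
    using d frac_laplacian_const_pos[OF s, of "DIM('a)"] unfolding iff
    by (auto simp: frac_laplacian_form_self enn2real_eq_0_iff)
  then have "AE x in lebesgue. ?d x = 0" by (rule energy_zero_imp_AE_zero[OF \<Omega> s0 d])
  then show ?thesis by eventually_elim simp
qed

section \<open>Boundedness by truncation\<close>

text \<open>For \<open>0 \<le> k\<close> this is Stampacchia's truncation
  \<open>sgn a * max (\<bar>a\<bar> - k) 0\<close>, also known as soft thresholding. It is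
  nondecreasing and 1-Lipschitz, and truncates positive and negative values at once.\<close>

definition excess :: "real \<Rightarrow> real \<Rightarrow> real" where
  "excess k a = a - max (-k) (min k a)"

lemma excess_diff_le: "0 \<le> k \<Longrightarrow> \<bar>excess k a - excess k b\<bar> \<le> 1 * \<bar>a - b\<bar>"
  by (auto simp: excess_def max_def min_def)

text \<open>By monotonicity and the Lipschitz bound, the difference of the excesses has the sign of
  \<open>a - b\<close> and no larger modulus.\<close>

lemma excess_diff_square_le:
  assumes "0 \<le> k"
  shows "(excess k a - excess k b) * (excess k a - excess k b) \<le> (a - b) * (excess k a - excess k b)"
proof -
  have "(a \<le> b \<longrightarrow> a - b \<le> excess k a - excess k b \<and> excess k a - excess k b \<le> 0) \<and>
        (b \<le> a \<longrightarrow> 0 \<le> excess k a - excess k b \<and> excess k a - excess k b \<le> a - b)"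
    using assms by (auto simp: excess_def max_def min_def)
  then show ?thesis by (metis linear mult_right_mono mult_right_mono_neg)
qed

lemma excess_eq_0_iff: "0 \<le> k \<Longrightarrow> excess k a = 0 \<longleftrightarrow> \<bar>a\<bar> \<le> k"
  by (auto simp: excess_def max_def min_def)

lemma excess_lower: "0 \<le> k \<Longrightarrow> h < \<bar>a\<bar> \<Longrightarrow> k < h \<Longrightarrow> (h - k)\<^sup>2 \<le> (excess k a)\<^sup>2"
  unfolding abs_le_square_iff[symmetric] by (auto simp: excess_def max_def min_def)

lemma measurable_excess [measurable]:
  assumes [measurable]: "u \<in> borel_measurable M"
  shows "(\<lambda>x. excess k (u x)) \<in> borel_measurable M"
  unfolding excess_def by measurable

lemma excess_frac_sobolev0:
  fixes \<Omega> :: "'a::euclidean_space set"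
  assumes \<Omega>: "\<Omega> \<in> sets lebesgue" "emeasure lebesgue \<Omega> \<le> ennreal M" "0 < M" "0 \<le> s"
    and u: "u \<in> frac_sobolev0 \<Omega> s 2" and k: "0 \<le> k"
  shows "(\<lambda>x. excess k (u x)) \<in> frac_sobolev0 \<Omega> s 2"
proof -
  note u' = u[unfolded frac_sobolev0_two_iff[OF \<Omega>]]
  have "gagliardo_energy s 2 (\<lambda>x. excess k (u x)) \<le> ennreal (1 powr 2) * gagliardo_energy s 2 u"
    using u' excess_diff_le[OF k] by (intro gagliardo_energy_mono_scaled) auto
  then have "gagliardo_energy s 2 (\<lambda>x. excess k (u x)) < \<infinity>"
    using u' by (auto intro: le_less_trans)
  moreover have "AE x in lebesgue. x \<notin> \<Omega> \<longrightarrow> excess k (u x) = 0"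
    using u'[THEN conjunct2, THEN conjunct2] by eventually_elim (use k in \<open>simp add: excess_eq_0_iff\<close>)
  ultimately show ?thesis
    using u' unfolding frac_sobolev0_two_iff[OF \<Omega>] by auto
qed

text \<open>The nonlocal counterpart of the identity between the gradients of \<open>u\<close> and
  of its truncation where the latter is nonzero. Pairs of points on different sides of the level
  leave only an inequality, which holds pointwise in the integrand.\<close>

lemma frac_laplacian_form_excess:
  fixes u :: "'a::euclidean_space \<Rightarrow> real"
  assumes [measurable]: "u \<in> borel_measurable lebesgue"
    and "gagliardo_energy s 2 u < \<infinity>" "gagliardo_energy s 2 (\<lambda>x. excess k (u x)) < \<infinity>"
    and k: "0 \<le> k" and s: "0 < s" "s < 1"
  shows "frac_laplacian_form s (\<lambda>x. excess k (u x)) (\<lambda>x. excess k (u x)) \<le> frac_laplacian_form s u (\<lambda>x. excess k (u x))"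
  unfolding frac_laplacian_form_def
proof (intro mult_left_mono integral_mono integrable_form)
  fix p :: "'a \<times> 'a"
  show "(case p of (x, y) \<Rightarrow> (excess k (u x) - excess k (u y)) * (excess k (u x) - excess k (u y)) / dist x y powr (real DIM('a) + 2 * s))
     \<le> (case p of (x, y) \<Rightarrow> (u x - u y) * (excess k (u x) - excess k (u y)) / dist x y powr (real DIM('a) + 2 * s))"
    by (auto simp: split_beta intro!: divide_right_mono excess_diff_square_le[OF k])
qed (use assms frac_laplacian_const_pos[OF s, of "DIM('a)"] in auto)

text \<open>Testing with the excess gives
  \<open>c * e \<le> Z * K * sqrt e * m powr (1/q - 1/2)\<close>, hence a bound on \<open>e\<close>
  with \<open>m powr (2/q - 1)\<close>. The Faber-Krahn inequality on the support contributes
  \<open>m powr (2 s / N)\<close>, and Chebyshev's inequality between the levels \<open>k\<close>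
  and \<open>h\<close> the division by \<open>(h - k)\<^sup>2\<close>. A positive upper bound
  \<open>m\<close> stands for the measure itself, which may be 0.\<close>

lemma level_set_decay:
  fixes \<Omega> :: "'a::euclidean_space set"
  assumes \<Omega>: "\<Omega> \<in> sets lebesgue" "emeasure lebesgue \<Omega> \<le> ennreal M" "0 < M"
    and q: "1 \<le> q" "q < 2" and "0 < t" "t < s" "s < 1"
  obtains L where "L > 0"
    "\<And>z u h k m. z \<in> frac_sobolev0_dual \<Omega> t q \<Longrightarrow> dirichlet_solution \<Omega> s z u \<Longrightarrow> 0 \<le> k \<Longrightarrow> k < h \<Longrightarrow>
      0 < m \<Longrightarrow> m \<le> M \<Longrightarrow> emeasure lebesgue {x. k < \<bar>u x\<bar>} \<le> ennreal m \<Longrightarrow>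
      emeasure lebesgue {x. h < \<bar>u x\<bar>} \<le>
        ennreal (L * (frac_sobolev0_dual_norm \<Omega> t q z)\<^sup>2 * m powr (2 * s / real DIM('a) + (2 / q - 1)) / (h - k)\<^sup>2)"
proof -
  have s: "0 \<le> s" "0 < s" using assms by auto
  note iff = frac_sobolev0_two_iff[OF \<Omega> s(1)]
  let ?N = "real DIM('a)"
  obtain K where K: "K > 0" "\<And>v m. v \<in> frac_sobolev0 \<Omega> s 2 \<Longrightarrow> 0 < m \<Longrightarrow> m \<le> M \<Longrightarrow> emeasure lebesgue {x. v x \<noteq> 0} \<le> ennreal m \<Longrightarrow>
      frac_sobolev0_norm t q v \<le> K * sqrt (enn2real (gagliardo_energy s 2 v)) * m powr (1 / q - 1 / 2)"
      "frac_sobolev0 \<Omega> s 2 \<subseteq> frac_sobolev0 \<Omega> t q"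
    using frac_sobolev0_embedding[OF \<Omega> q \<open>0 < t\<close> \<open>t < s\<close>] by metis
  define c where "c = frac_laplacian_const DIM('a) s / 2"
  have c: "c > 0" using frac_laplacian_const_pos[OF s(2) \<open>s < 1\<close>] by (simp add: c_def)
  define \<omega> where "\<omega> = unit_ball_vol ?N"
  have \<omega>: "\<omega> > 0" unfolding \<omega>_def by (rule unit_ball_vol_pos) simp
  \<comment> \<open>The Faber-Krahn constant with the power of \<open>m\<close> split off.\<close>
  define F where "F = 2 / \<omega> * (2 / \<omega>) powr (2 * s / ?N)"
  have F: "F > 0" using \<omega> by (simp add: F_def)
  let ?L = "F * (K / c)\<^sup>2"
  have "emeasure lebesgue {x. h < \<bar>u x\<bar>} \<le>
        ennreal (?L * (frac_sobolev0_dual_norm \<Omega> t q z)\<^sup>2 * m powr (2 * s / ?N + (2 / q - 1)) / (h - k)\<^sup>2)"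
    if z: "z \<in> frac_sobolev0_dual \<Omega> t q" and sol: "dirichlet_solution \<Omega> s z u" and k: "0 \<le> k" "k < h"
      and m: "0 < m" "m \<le> M" "emeasure lebesgue {x. k < \<bar>u x\<bar>} \<le> ennreal m" for z u h k m
  proof -
    define Z where "Z = frac_sobolev0_dual_norm \<Omega> t q z"
    have Z: "Z \<ge> 0" using frac_sobolev0_dual_bound(1)[OF z] q by (simp add: Z_def)
    have u: "u \<in> frac_sobolev0 \<Omega> s 2" and form: "\<And>v. v \<in> frac_sobolev0 \<Omega> s 2 \<Longrightarrow> frac_laplacian_form s u v = z v"
      using sol by (auto simp: dirichlet_solution_def)
    define v where "v x = excess k (u x)" for x
    have v: "v \<in> frac_sobolev0 \<Omega> s 2"
      unfolding v_def by (rule excess_frac_sobolev0[OF \<Omega> s(1) u k(1)])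
    note u' = u[unfolded iff] and v' = v[unfolded iff]
    have [measurable]: "u \<in> borel_measurable lebesgue" "v \<in> borel_measurable lebesgue" using u' v' by auto
    define e where "e = enn2real (gagliardo_energy s 2 v)"
    have e: "e \<ge> 0" "gagliardo_energy s 2 v = ennreal e" using v' by (auto simp: e_def)
    have "{x. v x \<noteq> 0} = {x. k < \<bar>u x\<bar>}" using k by (auto simp: v_def excess_eq_0_iff)
    then have supp: "emeasure lebesgue {x. v x \<noteq> 0} \<le> ennreal m" using m by simp
    let ?P = "m powr (1 / q - 1 / 2)"
    have "c * e = frac_laplacian_form s v v"
      using v' by (simp add: frac_laplacian_form_self c_def e_def)
    also have "\<dots> \<le> frac_laplacian_form s u v"
      using u' v' k s \<open>s < 1\<close> unfolding v_def by (intro frac_laplacian_form_excess) auto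
    also have "\<dots> = z v" by (rule form[OF v])
    also have "\<dots> \<le> Z * frac_sobolev0_norm t q v"
      using frac_sobolev0_dual_bound(2)[OF z, of v] v K(3) q by (auto simp: Z_def)
    also have "\<dots> \<le> Z * (K * sqrt e * ?P)"
      using K(2)[OF v m(1,2) supp] Z unfolding e_def by (rule mult_left_mono)
    finally have le: "c * sqrt e * sqrt e \<le> Z * K * ?P * sqrt e" using e by (simp add: mult_ac)
    have "sqrt e \<le> Z * K * ?P / c"
    \<comment> \<open>A factor \<open>sqrt e\<close> is cancelled, so zero energy is treated
      apart.\<close>
    proof (cases "e = 0")
      case False
      then have "c * sqrt e \<le> Z * K * ?P"
        using e by (intro mult_right_le_imp_le[OF le]) auto
      then show ?thesis using c by (simp add: pos_le_divide_eq mult.commute)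
    qed (use c Z K(1) in simp)
    then have "(sqrt e)\<^sup>2 \<le> (Z * K * ?P / c)\<^sup>2"
      using e by (intro power_mono) auto
    also have "\<dots> = (K / c)\<^sup>2 * Z\<^sup>2 * ?P\<^sup>2" by (simp add: power_mult_distrib power_divide)
    also have "?P\<^sup>2 = m powr (2 / q - 1)" using m by (simp add: powr_power right_diff_distrib)
    finally have e_le: "e \<le> (K / c)\<^sup>2 * Z\<^sup>2 * m powr (2 / q - 1)" using e by simp
    have "ennreal ((h - k)\<^sup>2) * emeasure lebesgue {x. h < \<bar>u x\<bar>} =
        (\<integral>\<^sup>+ x. ennreal ((h - k)\<^sup>2) * indicator {x. h < \<bar>u x\<bar>} x \<partial>lebesgue)"
      by (rule nn_integral_cmult_indicator[symmetric]) (auto intro: sets_lebesgue_Collect)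
    \<comment> \<open>Chebyshev: where \<open>\<bar>u\<bar> > h\<close>, the excess over
      \<open>k\<close> is larger than \<open>h - k\<close>.\<close>
    also have "\<dots> \<le> (\<integral>\<^sup>+ x. ennreal ((v x)\<^sup>2) \<partial>lebesgue)"
      using k by (intro nn_integral_mono) (auto simp: v_def split: split_indicator intro!: ennreal_leI excess_lower)
    also have "\<dots> \<le> ennreal (2 / \<omega> * (2 * m / \<omega>) powr (2 * s / ?N)) * gagliardo_energy s 2 v"
      unfolding \<omega>_def by (rule faber_krahn[OF _ s(1) m(1) supp]) measurable
    also have "2 / \<omega> * (2 * m / \<omega>) powr (2 * s / ?N) = F * m powr (2 * s / ?N)"
    proof -
      have "2 * m / \<omega> = (2 / \<omega>) * m" by simp
      then show ?thesis using \<omega> m by (simp only: F_def powr_mult mult.assoc)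
    qed
    also have "ennreal (F * m powr (2 * s / ?N)) * gagliardo_energy s 2 v = ennreal (F * m powr (2 * s / ?N) * e)"
      using F e by (simp add: ennreal_mult)
    also have "\<dots> \<le> ennreal (F * m powr (2 * s / ?N) * ((K / c)\<^sup>2 * Z\<^sup>2 * m powr (2 / q - 1)))"
      using F e_le by (intro ennreal_leI mult_left_mono) auto
    also have "F * m powr (2 * s / ?N) * ((K / c)\<^sup>2 * Z\<^sup>2 * m powr (2 / q - 1)) =
        ?L * Z\<^sup>2 * m powr (2 * s / ?N + (2 / q - 1))"
      by (simp add: powr_add mult_ac)
    finally have "ennreal ((h - k)\<^sup>2) * emeasure lebesgue {x. h < \<bar>u x\<bar>} \<le>
        ennreal (?L * Z\<^sup>2 * m powr (2 * s / ?N + (2 / q - 1)))" .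
    then have "ennreal (1 / (h - k)\<^sup>2) * (ennreal ((h - k)\<^sup>2) * emeasure lebesgue {x. h < \<bar>u x\<bar>}) \<le>
        ennreal (1 / (h - k)\<^sup>2) * ennreal (?L * Z\<^sup>2 * m powr (2 * s / ?N + (2 / q - 1)))"
      by (rule mult_left_mono) simp
    then show ?thesis
      using k F unfolding Z_def[symmetric]
      by (simp add: mult.assoc[symmetric] flip: ennreal_mult)
  qed
  moreover have "?L > 0" using F K c by simp
  ultimately show ?thesis by (rule that[rotated])
qed

text \<open>The level-set measures are dominated by a geometric sequence along the levels \<open>d (1 - 2\<^sup>-\<^sup>n)\<close>;
  the ratio \<open>2 powr (- 2 / (\<beta> - 1))\<close> is the one for which the recursion reproduces itself.\<close>

lemma stampacchia_iteration:
  fixes \<phi> :: "real \<Rightarrow> ennreal"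
  assumes decay: "\<And>h k m. 0 \<le> k \<Longrightarrow> k < h \<Longrightarrow> 0 < m \<Longrightarrow> m \<le> M \<Longrightarrow> \<phi> k \<le> ennreal m \<Longrightarrow>
      \<phi> h \<le> ennreal (L * m powr \<beta> / (h - k)\<^sup>2)"
    and mono: "\<And>k h. k \<le> h \<Longrightarrow> \<phi> h \<le> \<phi> k" and start: "\<phi> 0 \<le> ennreal M"
    and "1 < \<beta>" "0 < M" "0 \<le> L" "0 < d"
    and d: "L * M powr (\<beta> - 1) * 2 powr (2 + 2 / (\<beta> - 1)) \<le> d\<^sup>2"
  shows "\<phi> d = 0"
proof -
  \<comment> \<open>Chosen so that \<open>\<mu> * \<beta> = \<mu> + 2\<close>: raising to the power
    \<open>\<beta>\<close> improves the decay by 2 per step, which pays for dividing by squared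
    level gaps of order \<open>(1/4) ^ n\<close>.\<close>
  define \<mu> where "\<mu> = 2 / (\<beta> - 1)"
  have \<mu>: "\<mu> > 0" "\<mu> * \<beta> = \<mu> + 2" using \<open>1 < \<beta>\<close> by (auto simp: \<mu>_def field_simps)
  define k where "k n = d * (1 - (1/2) ^ n)" for n :: nat
  define m where "m n = M * 2 powr (- \<mu> * real n)" for n :: nat
  have m: "0 < m n" "m n \<le> M" for n
  proof -
    have "2 powr (- \<mu> * real n) \<le> 2 powr 0" using \<mu> by (intro powr_mono) auto
    then show "0 < m n" "m n \<le> M" using \<open>0 < M\<close> by (simp_all add: m_def)
  qed
  have step: "\<phi> (k n) \<le> ennreal (m n)" for n
  proof (induction n)
    case 0
    then show ?case using start by (simp add: k_def m_def)
  next
    case (Suc n)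
    have diff: "k (Suc n) - k n = d * (1/2) ^ Suc n" by (simp add: k_def algebra_simps)
    have "\<phi> (k (Suc n)) \<le> ennreal (L * m n powr \<beta> / (k (Suc n) - k n)\<^sup>2)"
    proof (rule decay)
      show "0 \<le> k n" using \<open>0 < d\<close> by (simp add: k_def power_le_one)
      have "0 < k (Suc n) - k n" unfolding diff using \<open>0 < d\<close> by simp
      then show "k n < k (Suc n)" by simp
    qed (use m Suc in auto)
    \<comment> \<open>The factor \<open>2 powr (2 + \<mu>)\<close> in the condition on
      \<open>d\<close> absorbs the shift from \<open>n\<close> to \<open>Suc n\<close>: it cancels
      one \<open>\<mu>\<close> and one 2 in the exponent, leaving
      \<open>-(\<mu> + 2) * n = - \<mu> * \<beta> * n\<close>.\<close>
    also have "L * m n powr \<beta> / (k (Suc n) - k n)\<^sup>2 \<le> m (Suc n)"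
    proof -
      have "(1/2::real) ^ Suc n = 2 powr (- real (Suc n))"
        by (simp only: powr_minus powr_realpow power_one_over inverse_eq_divide zero_less_numeral)
      then have "(k (Suc n) - k n)\<^sup>2 = d\<^sup>2 * 2 powr (- 2 * real (Suc n))"
        unfolding diff by (simp only: power_mult_distrib powr_power) simp
      then have "m (Suc n) * (k (Suc n) - k n)\<^sup>2 = d\<^sup>2 * (M * 2 powr (- \<mu> * real (Suc n) - 2 * real (Suc n)))"
        by (simp add: m_def powr_add powr_diff powr_minus field_simps)
      also have "\<dots> \<ge> (L * M powr (\<beta> - 1) * 2 powr (2 + \<mu>)) * (M * 2 powr (- \<mu> * real (Suc n) - 2 * real (Suc n)))"
        using d \<open>0 < M\<close> by (intro mult_right_mono) (auto simp: \<mu>_def)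
      also have "(L * M powr (\<beta> - 1) * 2 powr (2 + \<mu>)) * (M * 2 powr (- \<mu> * real (Suc n) - 2 * real (Suc n)))
          = L * (M powr (\<beta> - 1) * M) * (2 powr (2 + \<mu>) * 2 powr (- \<mu> * real (Suc n) - 2 * real (Suc n)))"
        by (simp only: mult_ac)
      also have "M powr (\<beta> - 1) * M = M powr \<beta>" using \<open>0 < M\<close> by (simp add: powr_diff)
      also have "2 powr (2 + \<mu>) * 2 powr (- \<mu> * real (Suc n) - 2 * real (Suc n)) = 2 powr (- \<mu> * real n * \<beta>)"
      proof -
        have "2 + \<mu> + (- \<mu> * real (Suc n) - 2 * real (Suc n)) = - (\<mu> * \<beta>) * real n"
          unfolding \<mu>(2) by (simp add: algebra_simps)
        then show ?thesis by (simp only: powr_add[symmetric]) (simp add: mult_ac)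
      qed
      also have "L * M powr \<beta> * 2 powr (- \<mu> * real n * \<beta>) = L * m n powr \<beta>"
        using \<open>0 < M\<close> by (simp add: m_def powr_mult powr_powr)
      finally have "L * m n powr \<beta> \<le> m (Suc n) * (k (Suc n) - k n)\<^sup>2" .
      moreover have "0 < (k (Suc n) - k n)\<^sup>2" unfolding diff using \<open>0 < d\<close> by simp
      ultimately show ?thesis by (simp only: pos_divide_le_eq)
    qed
    finally show ?case by (simp add: ennreal_leI)
  qed
  have "\<phi> d \<le> ennreal (M * (2 powr (- \<mu>)) ^ n)" for n
  proof -
    have "\<phi> d \<le> \<phi> (k n)" using \<open>0 < d\<close> by (intro mono) (simp add: k_def)
    also have "\<dots> \<le> ennreal (m n)" by (rule step)
    also have "m n = M * (2 powr (- \<mu>)) ^ n" by (simp add: m_def powr_power mult.commute)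
    finally show ?thesis .
  qed
  moreover have "(\<lambda>n. ennreal (M * (2 powr (- \<mu>)) ^ n)) \<longlonglongrightarrow> ennreal (M * 0)"
    using \<mu> by (intro tendsto_ennrealI tendsto_intros LIMSEQ_realpow_zero) (auto simp: powr_less_one)
  ultimately have "\<phi> d \<le> ennreal (M * 0)" by (intro tendsto_lowerbound[of _ _ sequentially]) auto
  then show ?thesis by simp
qed

text \<open>The iteration runs with the constant \<open>L * Z\<^sup>2\<close>, so its condition
  reads \<open>G * Z\<^sup>2 \<le> d\<^sup>2\<close>, where \<open>G\<close> does not depend on
  \<open>z\<close>. The admissible level is thus linear in the dual norm, with factor
  \<open>sqrt G\<close>.\<close>

lemma dirichlet_solution_AE_bound:
  fixes \<Omega> :: "'a::euclidean_space set"
  assumes \<Omega>: "\<Omega> \<in> sets lebesgue" "emeasure lebesgue \<Omega> \<le> ennreal M" "0 < M"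
    and q: "1 \<le> q" "q < 2" and "0 < t" "t < s" "s < 1"
    and exponent: "1 < 2 * s / real DIM('a) + (2 / q - 1)"
  obtains D where "D > 0"
    "\<And>z u. z \<in> frac_sobolev0_dual \<Omega> t q \<Longrightarrow> dirichlet_solution \<Omega> s z u \<Longrightarrow>
      AE x in lebesgue. \<bar>u x\<bar> \<le> D * frac_sobolev0_dual_norm \<Omega> t q z"
proof -
  define \<beta> where "\<beta> = 2 * s / real DIM('a) + (2 / q - 1)"
  obtain L where L: "L > 0"
    "\<And>z u h k m. z \<in> frac_sobolev0_dual \<Omega> t q \<Longrightarrow> dirichlet_solution \<Omega> s z u \<Longrightarrow> 0 \<le> k \<Longrightarrow> k < h \<Longrightarrow>
      0 < m \<Longrightarrow> m \<le> M \<Longrightarrow> emeasure lebesgue {x. k < \<bar>u x\<bar>} \<le> ennreal m \<Longrightarrow>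
      emeasure lebesgue {x. h < \<bar>u x\<bar>} \<le>
        ennreal (L * (frac_sobolev0_dual_norm \<Omega> t q z)\<^sup>2 * m powr \<beta> / (h - k)\<^sup>2)"
    using level_set_decay[OF \<Omega> q \<open>0 < t\<close> \<open>t < s\<close> \<open>s < 1\<close>] unfolding \<beta>_def by blast
  define G where "G = L * M powr (\<beta> - 1) * 2 powr (2 + 2 / (\<beta> - 1))"
  have G: "G > 0" using L(1) \<open>0 < M\<close> by (simp add: G_def)
  have "AE x in lebesgue. \<bar>u x\<bar> \<le> sqrt G * frac_sobolev0_dual_norm \<Omega> t q z"
    if z: "z \<in> frac_sobolev0_dual \<Omega> t q" and sol: "dirichlet_solution \<Omega> s z u" for z u
  proof -
    define Z where "Z = frac_sobolev0_dual_norm \<Omega> t q z"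
    have Z: "Z \<ge> 0" using frac_sobolev0_dual_bound(1)[OF z] q by (simp add: Z_def)
    have u: "u \<in> borel_measurable lebesgue" "AE x in lebesgue. x \<notin> \<Omega> \<longrightarrow> u x = 0"
      using sol by (auto simp: dirichlet_solution_def frac_sobolev0_def frac_sobolev_def)
    have [measurable]: "u \<in> borel_measurable lebesgue" by (rule u(1))
    have sets: "{x. h < \<bar>u x\<bar>} \<in> sets lebesgue" for h by (rule sets_lebesgue_Collect) measurable
    have null: "emeasure lebesgue {x. d < \<bar>u x\<bar>} = 0" if "sqrt G * Z \<le> d" "0 < d" for d
    proof (rule stampacchia_iteration[of M "\<lambda>k. emeasure lebesgue {x. k < \<bar>u x\<bar>}" "L * Z\<^sup>2" \<beta> d])
      show "emeasure lebesgue {x. h < \<bar>u x\<bar>} \<le> emeasure lebesgue {x. k < \<bar>u x\<bar>}" if "k \<le> h" for k h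
        using that sets by (intro emeasure_mono) auto
      have "{x. 0 < \<bar>u x\<bar>} = {x. u x \<noteq> 0}" by auto
      then show "emeasure lebesgue {x. 0 < \<bar>u x\<bar>} \<le> ennreal M"
        using emeasure_support_le[OF \<Omega>(1) u(2)] \<Omega>(2) by simp
      have "G * Z\<^sup>2 = (sqrt G * Z)\<^sup>2" using G by (simp add: power_mult_distrib)
      also have "\<dots> \<le> d\<^sup>2" using that G Z by (intro power_mono) auto
      finally show "L * Z\<^sup>2 * M powr (\<beta> - 1) * 2 powr (2 + 2 / (\<beta> - 1)) \<le> d\<^sup>2"
        by (simp add: G_def mult_ac)
    qed (use exponent \<open>0 < M\<close> L(1) L(2)[OF z sol] that in \<open>auto simp: \<beta>_def Z_def\<close>)
    \<comment> \<open>The iteration requires a positive level, whereas \<open>sqrt G * Z\<close> is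
      0 when the dual norm is 0. The shift is removed in the limit, after intersecting countably
      many sets of full measure.\<close>
    have "AE x in lebesgue. \<bar>u x\<bar> \<le> sqrt G * Z + inverse (real (Suc n))" for n
    proof (rule AE_I[OF _ null])
      show "{x \<in> space lebesgue. \<not> \<bar>u x\<bar> \<le> sqrt G * Z + inverse (real (Suc n))} \<subseteq>
          {x. sqrt G * Z + inverse (real (Suc n)) < \<bar>u x\<bar>}" by auto
      show "0 < sqrt G * Z + inverse (real (Suc n))" using G Z by (intro add_nonneg_pos) auto
    qed (use sets in auto)
    then have "AE x in lebesgue. \<forall>n. \<bar>u x\<bar> \<le> sqrt G * Z + inverse (real (Suc n))"
      by (subst AE_all_countable) blast
    then show ?thesis
      unfolding Z_def[symmetric]
    proof eventually_elim
      case (elim x)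
      have "(\<lambda>n. sqrt G * Z + inverse (real (Suc n))) \<longlonglongrightarrow> sqrt G * Z + 0"
        by (intro tendsto_intros LIMSEQ_inverse_real_of_nat)
      then have "\<bar>u x\<bar> \<le> sqrt G * Z + 0"
        by (rule tendsto_lowerbound) (use elim in auto)
      then show ?case by simp
    qed
  qed
  moreover have "sqrt G > 0" using G by simp
  ultimately show ?thesis by (rule that[rotated])
qed

section \<open>From the almost everywhere bound to the essential supremum on
  \<open>\<Omega>\<close>\<close>

lemma Linfty_of_AE_bound:
  fixes \<Omega> :: "'a::euclidean_space set"
  assumes "\<Omega> \<in> sets lebesgue" "u \<in> borel_measurable lebesgue" "AE x in lebesgue. \<bar>u x\<bar> \<le> c"
  shows "u \<in> Linfty \<Omega>" and "Linfty_norm \<Omega> u \<le> ennreal c"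
proof -
  have [measurable]: "u \<in> borel_measurable (lebesgue_on \<Omega>)"
    using assms(2) by (rule measurable_restrict_space1)
  have "AE x in lebesgue_on \<Omega>. ennreal \<bar>u x\<bar> \<le> ennreal c"
    using assms(1,3) by (subst AE_restrict_space_iff) (auto intro: ennreal_leI)
  then show "Linfty_norm \<Omega> u \<le> ennreal c"
    unfolding Linfty_norm_def by (intro esssup_I) measurable
  then show "u \<in> Linfty \<Omega>"
    unfolding Linfty_def by (auto intro: le_less_trans)
qed

theorem theorem6p3:
  fixes \<Omega> :: "(real ^ 'n) set" and s t :: real and p :: ereal
  assumes "open \<Omega>" and "bounded \<Omega>" and "lipschitz_boundary \<Omega>"
    and "0 < t" and "t < s" and "s < 1"
    and "2 < real CARD('n) / s" and "ereal (real CARD('n) / s) < p" and "p \<le> \<infinity>"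
    and "1 \<le> conj_exponent p" and "conj_exponent p < 2"
    and "1 / conj_exponent p < t" and "t < 1"
  shows "(\<forall>z\<in>neg_sobolev \<Omega> t p.
            \<exists>u. dirichlet_solution \<Omega> s z u \<and>
                (\<forall>w. dirichlet_solution \<Omega> s z w \<longrightarrow> (AE x in lebesgue. w x = u x))) \<and>
         (\<exists>C>0. \<forall>z\<in>neg_sobolev \<Omega> t p. \<forall>u. dirichlet_solution \<Omega> s z u \<longrightarrow>
            u \<in> Linfty \<Omega> \<and> Linfty_norm \<Omega> u \<le> ennreal (C * neg_sobolev_norm \<Omega> t p z))"
proof -
  define q where "q = conj_exponent p"
  have q: "1 \<le> q" "q < 2" using assms by (auto simp: q_def)
  have s: "0 < s" using assms by simp
  \<comment> \<open>The summand 1 keeps the volume bound positive even for empty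
    \<open>\<Omega>\<close>.\<close>
  define M where "M = measure lebesgue \<Omega> + 1"
  have lm: "\<Omega> \<in> lmeasurable" using assms by (intro lmeasurable_open)
  have \<Omega>: "\<Omega> \<in> sets lebesgue" "emeasure lebesgue \<Omega> \<le> ennreal M" "0 < M"
    using lm by (auto simp: M_def emeasure_eq_measure2 fmeasurableD add_nonneg_pos intro: ennreal_leI)
  \<comment> \<open>For finite \<open>p = r\<close> the relation \<open>1/q = 1 - 1/r\<close> turns
    the right-hand side into \<open>1 + 2 * (s/N - 1/r)\<close>. For infinite \<open>p\<close> it is
    \<open>1 + 2 s / N\<close>, since \<open>q = 1\<close>.\<close>
  have exponent: "1 < 2 * s / real DIM(real ^ 'n) + (2 / q - 1)"
  proof (cases p)
    case (real r)
    have "real CARD('n) / s < r" using assms(8) real by simp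
    moreover from this have "r > 2" using assms(7) by simp
    ultimately have "1 / r < s / real CARD('n)" using s by (simp add: field_simps)
    moreover have "1 / q = 1 - 1 / r" using real \<open>r > 2\<close> by (simp add: q_def conj_exponent_def field_simps)
    ultimately show ?thesis by simp
  qed (use assms s in \<open>auto simp: q_def conj_exponent_def\<close>)
  have ns: "neg_sobolev \<Omega> t p = frac_sobolev0_dual \<Omega> t q" "neg_sobolev_norm \<Omega> t p = frac_sobolev0_dual_norm \<Omega> t q"
    by (auto simp: neg_sobolev_def neg_sobolev_norm_def q_def)
  obtain K where K: "K > 0" "frac_sobolev0 \<Omega> s 2 \<subseteq> frac_sobolev0 \<Omega> t q"
    "\<And>v m. v \<in> frac_sobolev0 \<Omega> s 2 \<Longrightarrow> 0 < m \<Longrightarrow> m \<le> M \<Longrightarrow> emeasure lebesgue {x. v x \<noteq> 0} \<le> ennreal m \<Longrightarrow>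
      frac_sobolev0_norm t q v \<le> K * sqrt (enn2real (gagliardo_energy s 2 v)) * m powr (1 / q - 1 / 2)"
    using frac_sobolev0_embedding[OF \<Omega> q \<open>0 < t\<close> \<open>t < s\<close>] by blast
  have ex: "\<exists>u. dirichlet_solution \<Omega> s z u" if z: "z \<in> frac_sobolev0_dual \<Omega> t q" for z
  proof (rule dirichlet_solution_exists[OF \<Omega> s \<open>s < 1\<close>])
    let ?Z = "frac_sobolev0_dual_norm \<Omega> t q z"
    show "z (\<lambda>x. u x + v x) = z u + z v" if "u \<in> frac_sobolev0 \<Omega> s 2" "v \<in> frac_sobolev0 \<Omega> s 2" for u v
      using z K(2) that unfolding frac_sobolev0_dual_def by blast
    show "z (\<lambda>x. c * u x) = c * z u" if "u \<in> frac_sobolev0 \<Omega> s 2" for c u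
      using z K(2) that unfolding frac_sobolev0_dual_def by blast
    \<comment> \<open>For existence no smallness of the support is exploited: the embedding is used
      with the largest volume \<open>m = M\<close>.\<close>
    show "\<bar>z u\<bar> \<le> (?Z * K * M powr (1 / q - 1 / 2)) * sqrt (enn2real (gagliardo_energy s 2 u))"
      if u: "u \<in> frac_sobolev0 \<Omega> s 2" for u
    proof -
      have "emeasure lebesgue {x. u x \<noteq> 0} \<le> ennreal M"
        using u emeasure_support_le[OF \<Omega>(1)] \<Omega>(2) by (auto simp: frac_sobolev0_def intro: order_trans)
      then have "frac_sobolev0_norm t q u \<le> K * sqrt (enn2real (gagliardo_energy s 2 u)) * M powr (1 / q - 1 / 2)"
        by (rule K(3)[OF u \<Omega>(3) order_refl])
      then have "?Z * frac_sobolev0_norm t q u \<le> ?Z * (K * sqrt (enn2real (gagliardo_energy s 2 u)) * M powr (1 / q - 1 / 2))"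
        using frac_sobolev0_dual_bound(1)[OF z] q by (intro mult_left_mono) auto
      then show ?thesis
        using frac_sobolev0_dual_bound(2)[OF z, of u] u K(2) q by (auto simp: mult_ac)
    qed
  qed
  obtain D where D: "D > 0"
    "\<And>z u. z \<in> frac_sobolev0_dual \<Omega> t q \<Longrightarrow> dirichlet_solution \<Omega> s z u \<Longrightarrow>
      AE x in lebesgue. \<bar>u x\<bar> \<le> D * frac_sobolev0_dual_norm \<Omega> t q z"
    using dirichlet_solution_AE_bound[OF \<Omega> q \<open>0 < t\<close> \<open>t < s\<close> \<open>s < 1\<close> exponent] by blast
  show ?thesis
    unfolding ns
  proof (intro conjI ballI exI[of _ D] allI impI)
    fix z assume "z \<in> frac_sobolev0_dual \<Omega> t q"
    then obtain u where u: "dirichlet_solution \<Omega> s z u" using ex by blast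
    then show "\<exists>u. dirichlet_solution \<Omega> s z u \<and>
        (\<forall>w. dirichlet_solution \<Omega> s z w \<longrightarrow> (AE x in lebesgue. w x = u x))"
      using dirichlet_solution_unique[OF \<Omega> s \<open>s < 1\<close> u] by blast
  next
    fix z u assume z: "z \<in> frac_sobolev0_dual \<Omega> t q" and u: "dirichlet_solution \<Omega> s z u"
    have "u \<in> borel_measurable lebesgue"
      using u by (auto simp: dirichlet_solution_def frac_sobolev0_def frac_sobolev_def)
    note bound = Linfty_of_AE_bound[OF \<Omega>(1) this D(2)[OF z u]]
    show "u \<in> Linfty \<Omega>" "Linfty_norm \<Omega> u \<le> ennreal (D * frac_sobolev0_dual_norm \<Omega> t q z)"
      by (rule bound)+
  qed (rule D(1))
qed

end
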